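(* Let $G_1$ and $G_2$ be finite simple connected graphs, let $Y$ be a nonempty graph which is a full subgraph of both $G_1$ and $G_2$, and let $G = G_1\cup_Y G_2$. Then $$\tau(G)=N(G_1,F,V(Y))\,N(G_2,F,V(Y))\,\frac{{\det}'\big(\mathrm{DN}(G_1,Y,G_2)\big)}{|V(Y)|},$$ where $\mathrm{DN}(G_1,Y,G_2)=\mathrm{DN}(G_1,Y)+\mathrm{DN}(G_2,Y)-L(Y)$.
   Context: $\tau(H)$ denotes the number of spanning trees of $H$. With $k=|V(Y)|$, $N(G_i,F,V(Y))$ denotes the number of spanning forests of $G_i$ with exactly $k$ connected components that are rooted in $V(Y)$, i.e. each component contains exactly one vertex of $V(Y)$ (its root). For a square matrix $M$, the pseudo-determinant ${\det}'(M)$ is the product of the non-zero eigenvalues of $M$ (with multiplicity; an empty product is $1$). A subgraph $Y$ of a graph $H$ is full if $u,v\in V(Y)$ and $\{u,v\}\in E(H)$ imply $\{u,v\}\in E(Y)$. If $Y$ is a full subgraph of $G_1$ and of $G_2$, then $G_1\cup_Y G_2$ is the graph obtained from the disjoint union of $G_1$ and $G_2$ by identifying the two copies of each vertex of $Y$ and the two copies of each edge of $Y$. $L(H)$ is the graph Laplacian: $L(H)(u,u)$ is the degree of $u$ in $H$, $L(H)(u,v)=-1$ if $\{u,v\}\in E(H)$, and $0$ otherwise. Dirichlet-to-Neumann map: for a finite simple connected graph $H$ and a nonempty full subgraph $Y$ of $H$, write $L(H)=\begin{bmatrix} A & B\\ B^T & D\end{bmatrix}$ with $A$ indexed by $V(H)\setminus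 V(Y)$ and $D$ by $V(Y)$. Then $A$ is invertible and $\mathrm{DN}(H,Y)=D-B^TA^{-1}B$, a matrix indexed by $V(Y)$. *)

theory Defs
  imports
    "HOL-Computational_Algebra.Polynomial"
    "Jordan_Normal_Form.Char_Poly"
    "Jordan_Normal_Form.Gauss_Jordan_Elimination"
    "Graph_Theory.Graph_Theory"
begin

text \<open>
  A finite simple graph is a \<^locale>\<open>pair_graph\<close>: a finite loop-free symmetric digraph in which an
  undirected edge \<open>{u, v}\<close> is represented by the two arcs \<open>(u, v)\<close> and \<open>(v, u)\<close>. A full subgraph is
  a \<^const>\<open>induced_subgraph\<close>.
\<close>

section \<open>Spanning trees and rooted spanning forests\<close>

text \<open>
  The library's \<^const>\<open>forest\<close> and \<^const>\<open>spanning_tree\<close> exclude all directed cycles. For a symmetric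
  digraph this is too strong, because \<open>u, v, u\<close> is then a directed cycle as soon as \<open>{u, v}\<close> is an
  edge. The cycles of the undirected graph are the directed cycles of length at least three.
\<close>

definition undirected_forest :: "'a pair_pre_digraph \<Rightarrow> bool" where
  "undirected_forest H \<longleftrightarrow>
     pair_graph H \<and> \<not> (\<exists>p. pre_digraph.cycle (with_proj H) p \<and> 3 \<le> length p)"

definition undirected_tree :: "'a pair_pre_digraph \<Rightarrow> bool" where
  "undirected_tree H \<longleftrightarrow> undirected_forest H \<and> Digraph_Component.connected (with_proj H)"

definition num_spanning_trees :: "'a pair_pre_digraph \<Rightarrow> nat" where
  "num_spanning_trees H =
     card {T. undirected_tree T \<and> spanning (with_proj T) (with_proj H)}"

text \<open>
  The connected components of a symmetric digraph are its strongly connected components; their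
  vertex sets form \<^const>\<open>pre_digraph.sccs_verts\<close>. The root of a component is determined by the
  component, so that counting rooted forests amounts to counting forests.
\<close>

definition num_rooted_spanning_forests :: "'a pair_pre_digraph \<Rightarrow> 'a set \<Rightarrow> nat" where
  "num_rooted_spanning_forests H R =
     card {F. undirected_forest F \<and> spanning (with_proj F) (with_proj H) \<and>
              card (pre_digraph.sccs_verts (with_proj F)) = card R \<and>
              (\<forall>C \<in> pre_digraph.sccs_verts (with_proj F). \<exists>!r. r \<in> C \<and> r \<in> R)}"

section \<open>Gluing two graphs along a common full subgraph\<close>

text \<open>
  \<open>G\<^sub>1\<close> and \<open>G\<^sub>2\<close> may share vertices outside \<open>Y\<close>. They are made disjoint by the sum type, in which
  the vertices of \<open>G\<^sub>1\<close>, and with them those of \<open>Y\<close>, are tagged \<^const>\<open>Inl\<close>, and the vertices of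
  \<open>G\<^sub>2\<close> outside \<open>Y\<close> are tagged \<^const>\<open>Inr\<close>.
\<close>

definition glue_right :: "'a pair_pre_digraph \<Rightarrow> 'a \<Rightarrow> 'a + 'a" where
  "glue_right Y v = (if v \<in> pverts Y then Inl v else Inr v)"

definition glue ::
  "'a pair_pre_digraph \<Rightarrow> 'a pair_pre_digraph \<Rightarrow> 'a pair_pre_digraph \<Rightarrow> ('a + 'a) pair_pre_digraph"
where
  "glue G1 Y G2 =
     \<lparr> pverts = Inl ` pverts G1 \<union> glue_right Y ` pverts G2,
       parcs = map_prod Inl Inl ` parcs G1 \<union> map_prod (glue_right Y) (glue_right Y) ` parcs G2 \<rparr>"

section \<open>Matrices indexed by finite sets\<close>

text \<open>
  A matrix with rows indexed by \<open>S\<close> and columns indexed by \<open>T\<close> is represented by a \<^typ>\<open>'b mat\<close>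
  through an arbitrary enumeration of each index set. The enumeration depends only on the set, so
  that matrices over the same index sets can be added and multiplied.
\<close>

definition enum_of :: "'a set \<Rightarrow> 'a list" where
  "enum_of S = (SOME xs. set xs = S \<and> distinct xs)"

definition mat_on :: "'a set \<Rightarrow> 'a set \<Rightarrow> ('a \<Rightarrow> 'a \<Rightarrow> 'b) \<Rightarrow> 'b mat" where
  "mat_on S T f = mat (card S) (card T) (\<lambda>(i, j). f (enum_of S ! i) (enum_of T ! j))"

definition pseudo_det :: "complex mat \<Rightarrow> complex" where
  "pseudo_det M = (\<Prod>x \<in># filter_mset (\<lambda>x. x \<noteq> 0) (proots (char_poly M)). x)"

section \<open>Laplacian and Dirichlet-to-Neumann map\<close>

text \<open>By symmetry the degree of a vertex of a \<^locale>\<open>pair_graph\<close> is its out-degree.\<close>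

definition laplacian :: "'a pair_pre_digraph \<Rightarrow> 'a \<Rightarrow> 'a \<Rightarrow> real" where
  "laplacian H u v =
     (if u = v then real (out_degree (with_proj H) u)
      else if (u, v) \<in> parcs H then -1 else 0)"

definition DN :: "'a pair_pre_digraph \<Rightarrow> 'a pair_pre_digraph \<Rightarrow> real mat" where
  "DN H Y =
     (let I = pverts H - pverts Y;
          A = mat_on I I (laplacian H);
          B = mat_on I (pverts Y) (laplacian H);
          D = mat_on (pverts Y) (pverts Y) (laplacian H)
      in D - transpose_mat B * the (mat_inverse A) * B)"

definition DN_glue ::
  "'a pair_pre_digraph \<Rightarrow> 'a pair_pre_digraph \<Rightarrow> 'a pair_pre_digraph \<Rightarrow> real mat"
where
  "DN_glue G1 Y G2 = DN G1 Y + DN G2 Y - mat_on (pverts Y) (pverts Y) (laplacian Y)"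

end

theory Submission
  imports Defs
begin

text \<open>
  All three counts are determinants of principal submatrices of Laplacians, and block elimination
  relates these determinants.

  The link is the matrix-tree theorem for forests: deleting the rows and columns of a vertex set
  \<open>R\<close> from the Laplacian of \<open>H\<close> leaves a matrix whose determinant is the number of spanning
  forests rooted in \<open>R\<close>. Row \<open>v\<close> of the Laplacian is a sum over the neighbours of \<open>v\<close>, so by
  multilinearity the determinant is a sum over all maps choosing a neighbour of each \<open>v \<notin> R\<close>. Such
  a map contributes \<open>1\<close> if following it always leads to \<open>R\<close>, and \<open>0\<close> otherwise
  (\<open>set_det_laplacian_eq_card_parent_maps\<close>). The contributing maps are the parent maps of the rooted
  forests (\<open>card_rooted_forests\<close>). With \<open>R = {y}\<close> the theorem counts spanning trees.

  For the glued graph \<open>G\<close> delete one vertex \<open>y\<close> of \<open>Y\<close>. The blocks of \<open>G1\<close> outside \<open>Y\<close> and of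
  \<open>G2\<close> outside \<open>Y\<close> are not joined by edges, so they can be eliminated independently
  (\<open>set_det_Schur\<close>, \<open>set_det_laplacian_G\<close>). They contribute the two forest counts as factors, and
  what remains is a Schur complement indexed by \<open>Y\<close> without \<open>y\<close>. On \<open>Y\<close> the Laplacian of \<open>G\<close> is
  the sum of those of \<open>G1\<close> and \<open>G2\<close> minus that of \<open>Y\<close>, so this is the matrix
  \<open>S = DN_glue G1 Y G2\<close> with the row and column of \<open>y\<close> deleted. Hence \<open>\<tau>(G)\<close> is the product of
  the two forest counts and the cofactor of \<open>S\<close> at \<open>y\<close>.

  Finally \<open>S\<close> inherits vanishing row and column sums from the Laplacians. For such a matrix of size
  \<open>k\<close> the characteristic polynomial is \<open>X q\<close>, where \<open>q(0)\<close> is, up to sign, \<open>k\<close> times the cofactor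
  (\<open>char_poly_zero_sums\<close>). The cofactor is non-zero since \<open>G\<close> is connected, so the eigenvalue \<open>0\<close> is
  simple and the product of the other eigenvalues is \<open>k\<close> times the cofactor
  (\<open>pseudo_det_zero_sums\<close>).
\<close>

section \<open>Determinants indexed by finite sets\<close>

text \<open>
  The Leibniz formula over the permutations of the index set itself. Since no ordering of the
  vertices enters, determinants can be split along unions of vertex sets and transported along
  bijections without tracking positions in an enumeration.
\<close>

definition set_det :: "'a set \<Rightarrow> ('a \<Rightarrow> 'a \<Rightarrow> 'b::comm_ring_1) \<Rightarrow> 'b" where
  "set_det I f = (\<Sum>p | p permutes I. of_int (sign p) * (\<Prod>v\<in>I. f v (p v)))"

definition list_mat :: "'a list \<Rightarrow> 'a list \<Rightarrow> ('a \<Rightarrow> 'a \<Rightarrow> 'b) \<Rightarrow> 'b mat" where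
  "list_mat xs ys f = mat (length xs) (length ys) (\<lambda>(i, j). f (xs ! i) (ys ! j))"

lemma list_mat_carrier [simp]: "list_mat xs ys f \<in> carrier_mat (length xs) (length ys)"
  by (simp add: list_mat_def)

lemma list_mat_index [simp]:
  "i < length xs \<Longrightarrow> j < length ys \<Longrightarrow> list_mat xs ys f $$ (i, j) = f (xs ! i) (ys ! j)"
  "dim_row (list_mat xs ys f) = length xs"
  "dim_col (list_mat xs ys f) = length ys"
  by (simp_all add: list_mat_def)

lemma list_mat_cong:
  "(\<And>u v. u \<in> set xs \<Longrightarrow> v \<in> set ys \<Longrightarrow> f u v = g u v) \<Longrightarrow> list_mat xs ys f = list_mat xs ys g"
  by (rule eq_matI) auto

text \<open>
  An entry of a product is a sum over positions in the common enumeration; absence of repetitions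
  turns it into a sum over vertices.
\<close>

lemma list_mat_mult:
  assumes "distinct ys"
  shows "list_mat xs ys f * list_mat ys zs g =
           list_mat xs zs (\<lambda>u w. \<Sum>v\<in>set ys. f u v * g v w)"
proof (rule eq_matI, goal_cases)
  case (1 i j)
  have "bij_betw (\<lambda>k. ys ! k) {0..<length ys} (set ys)"
    using bij_betw_nth[OF assms, of "{0..<length ys}" "set ys"] by (auto simp: atLeast0LessThan)
  from sum.reindex_bij_betw[OF this, of "\<lambda>v. f (xs ! i) v * g v (zs ! j)"] 1
  show ?case by (simp add: scalar_prod_def)
qed auto

lemma list_mat_one: "distinct xs \<Longrightarrow> list_mat xs xs (\<lambda>u v. if u = v then 1 else 0) = 1\<^sub>m (length xs)"
  by (rule eq_matI) (auto simp: nth_eq_iff_index_eq)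

lemma list_mat_append:
  "list_mat (xs @ ys) (xs @ ys) f =
     four_block_mat (list_mat xs xs f) (list_mat xs ys f) (list_mat ys xs f) (list_mat ys ys f)"
  by (rule eq_matI) (auto simp: nth_append)

lemma enum_of: "finite S \<Longrightarrow> set (enum_of S) = S" "finite S \<Longrightarrow> distinct (enum_of S)"
  using someI_ex[OF finite_distinct_list, of S] by (auto simp: enum_of_def)

lemma length_enum_of [simp]: "finite S \<Longrightarrow> length (enum_of S) = card S"
  using enum_of[of S] distinct_card by fastforce

lemma mat_on_eq_list_mat:
  "finite S \<Longrightarrow> finite T \<Longrightarrow> mat_on S T f = list_mat (enum_of S) (enum_of T) f"
  by (simp add: mat_on_def list_mat_def)

lemma set_det_cong:
  assumes "I = J" "\<And>u v. u \<in> J \<Longrightarrow> v \<in> J \<Longrightarrow> f u v = g u v"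
  shows "set_det I f = set_det J g"
  unfolding set_det_def assms(1)
  by (intro sum.cong refl arg_cong2[of _ _ _ _ "(*)"] prod.cong) (auto simp: assms(2) permutes_in_image)

text \<open>
  Conjugation by the bijection identifies the permutations of the two index sets and preserves signs.
\<close>

lemma set_det_reindex:
  assumes bij: "bij_betw g A B" and fin: "finite A"
  shows "set_det B f = set_det A (\<lambda>u v. f (g u) (g v))"
proof -
  have inj: "inj_on g A" and B: "B = g ` A"
    using bij by (auto simp: bij_betw_def)
  let ?h = "inv_into A g"
  show ?thesis
    unfolding set_det_def
  proof (rule sum.reindex_bij_witness[of _ "map_permutation A g" "map_permutation B ?h"], goal_cases)
    case (1 p)
    show ?case
      by (rule map_permutation_compose_inv[OF bij_betw_inv_into[OF bij]])
         (use 1 inj in \<open>auto simp: B f_inv_into_f\<close>)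
  next
    case (2 p)
    then show ?case using map_permutation_permutes[OF bij_betw_inv_into[OF bij]] by auto
  next
    case (3 p)
    show ?case
      by (rule map_permutation_compose_inv[OF bij]) (use 3 inj in auto)
  next
    case (4 p)
    then show ?case using map_permutation_permutes[OF bij] by auto
  next
    case (5 p)
    have inj': "inj_on ?h B" using B by (simp add: inj_on_inv_into)
    have p: "p permutes B" using 5 by simp
    have s: "sign (map_permutation B ?h p) = sign p"
      using sign_map_permutation[OF inj' p] fin B by simp
    have "(\<Prod>v\<in>B. f v (p v)) = (\<Prod>u\<in>A. f (g u) (p (g u)))"
      using prod.reindex_bij_betw[OF bij, of "\<lambda>v. f v (p v)"] by simp
    also have "\<dots> = (\<Prod>u\<in>A. f (g u) (g (map_permutation B ?h p u)))"
    proof (rule prod.cong[OF refl])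
      fix u assume u: "u \<in> A"
      have "map_permutation B ?h p (?h (g u)) = ?h (p (g u))"
        by (rule map_permutation_apply[OF inj']) (use u B in auto)
      moreover have "g (?h (p (g u))) = p (g u)"
        by (rule f_inv_into_f) (use u B p in \<open>auto simp: permutes_in_image\<close>)
      ultimately show "f (g u) (p (g u)) = f (g u) (g (map_permutation B ?h p u))"
        using u inj by simp
    qed
    finally show ?case by (simp add: s)
  qed
qed

lemma set_det_list_mat:
  assumes "distinct xs"
  shows "det (list_mat xs xs f) = set_det (set xs) f"
proof -
  have bij: "bij_betw (\<lambda>k. xs ! k) {0..<length xs} (set xs)"
    using bij_betw_nth[OF assms, of "{0..<length xs}" "set xs"] by (auto simp: atLeast0LessThan)
  have "det (list_mat xs xs f) = set_det {0..<length xs} (\<lambda>i j. f (xs ! i) (xs ! j))"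
    unfolding set_det_def det_def'[OF list_mat_carrier]
    by (intro sum.cong refl arg_cong2[of _ _ _ _ "(*)"] prod.cong) (auto simp: permutes_in_image)
  with set_det_reindex[OF bij, of f] show ?thesis by simp
qed

lemma set_det_mult:
  assumes "finite I"
  shows "set_det I f * set_det I g = set_det I (\<lambda>u w. \<Sum>v\<in>I. f u v * g v w)"
proof -
  obtain xs where xs: "set xs = I" "distinct xs"
    using finite_distinct_list[OF assms] by blast
  show ?thesis
    using det_mult[of "list_mat xs xs f" "length xs" "list_mat xs xs g"] xs
    by (simp add: set_det_list_mat list_mat_mult)
qed

lemma set_det_one:
  assumes "finite I"
  shows "set_det I (\<lambda>u v. if u = v then 1 else 0) = 1"
proof -
  obtain xs where xs: "set xs = I" "distinct xs"
    using finite_distinct_list[OF assms] by blast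
  show ?thesis
    using set_det_list_mat[of xs "\<lambda>u v. if u = v then 1 else 0"] xs by (simp add: list_mat_one)
qed

lemma set_det_transpose:
  assumes "finite I"
  shows "set_det I (\<lambda>u v. f v u) = set_det I f"
proof -
  obtain xs where xs: "set xs = I" "distinct xs"
    using finite_distinct_list[OF assms] by blast
  have "list_mat xs xs (\<lambda>u v. f v u) = transpose_mat (list_mat xs xs f)"
    by (rule eq_matI) auto
  then show ?thesis
    using det_transpose[of "list_mat xs xs f" "length xs"] xs
    by (metis list_mat_carrier set_det_list_mat)
qed

section \<open>Block elimination and row expansion\<close>

text \<open>
  Gaussian elimination of the block \<open>I\<close>: with \<open>g\<close> a left inverse of that block, subtracting
  \<open>C g\<close> times the rows in \<open>I\<close> from the rows in \<open>J\<close>, where \<open>C\<close> is the lower left block, makes the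
  matrix block upper triangular, with the Schur complement in the lower right corner.
\<close>

lemma set_det_Schur:
  fixes f :: "'a \<Rightarrow> 'a \<Rightarrow> 'b::idom"
  assumes fin: "finite I" "finite J" and disj: "I \<inter> J = {}"
    and inv: "\<And>a c. a \<in> I \<Longrightarrow> c \<in> I \<Longrightarrow> (\<Sum>b\<in>I. g a b * f b c) = (if a = c then 1 else 0)"
  shows "set_det (I \<union> J) f =
           set_det I f * set_det J (\<lambda>u v. f u v - (\<Sum>b\<in>I. (\<Sum>a\<in>I. f u a * g a b) * f b v))"
proof -
  obtain xs ys where xs: "set xs = I" "distinct xs" and ys: "set ys = J" "distinct ys"
    using finite_distinct_list[OF fin(1)] finite_distinct_list[OF fin(2)] by blast
  let ?m = "length xs" and ?n = "length ys"
  let ?A = "list_mat xs xs f" and ?B = "list_mat xs ys f"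
    and ?C = "list_mat ys xs f" and ?D = "list_mat ys ys f" and ?G = "list_mat xs xs g"
  let ?M = "four_block_mat ?A ?B ?C ?D"
  let ?N = "four_block_mat (1\<^sub>m ?m) (0\<^sub>m ?m ?n) (- (?C * ?G)) (1\<^sub>m ?n)"
  define S where "S u v = f u v - (\<Sum>b\<in>I. (\<Sum>a\<in>I. f u a * g a b) * f b v)" for u v
  have GA: "?G * ?A = 1\<^sub>m ?m"
    unfolding list_mat_mult[OF xs(2)] list_mat_one[OF xs(2), symmetric]
    by (rule list_mat_cong) (simp add: xs inv)
  have CG: "?C * ?G \<in> carrier_mat ?n ?m" by (intro mult_carrier_mat) auto
  have CGA: "- (?C * ?G) * ?A + ?C = 0\<^sub>m ?n ?m"
  proof -
    have "- (?C * ?G) * ?A = - (?C * ?G * ?A)"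
      by (rule uminus_mult_left_mat) auto
    also have "?C * ?G * ?A = ?C * (?G * ?A)"
      by (rule assoc_mult_mat) auto
    finally have "- (?C * ?G) * ?A = - ?C"
      using right_mult_one_mat[of ?C ?n ?m] by (simp add: GA)
    then show ?thesis
      using uminus_l_inv_mat[of ?C ?n ?m] by simp
  qed
  have CGB: "- (?C * ?G) * ?B + ?D = list_mat ys ys S"
  proof -
    have "- (?C * ?G) * ?B = - (?C * ?G * ?B)"
      by (rule uminus_mult_left_mat) auto
    also have "\<dots> = - list_mat ys ys (\<lambda>u v. \<Sum>b\<in>I. (\<Sum>a\<in>I. f u a * g a b) * f b v)"
      by (simp add: list_mat_mult xs)
    finally show ?thesis
      by (intro eq_matI) (auto simp: S_def)
  qed
  have NM: "?N * ?M = four_block_mat ?A ?B (0\<^sub>m ?n ?m) (list_mat ys ys S)"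
    by (subst mult_four_block_mat[where ?nr1.0 = ?m and ?n1.0 = ?m and ?n2.0 = ?n and ?nr2.0 = ?n
          and ?nc1.0 = ?m and ?nc2.0 = ?n])
       (use CG in \<open>simp_all add: CGA CGB del: assoc_mult_mat uminus_mult_left_mat\<close>)
  have "det ?N = 1"
    by (subst det_four_block_mat_upper_right_zero[where n = ?m and m = ?n]) (use CG in auto)
  then have "det ?M = det (?N * ?M)"
    by (subst det_mult[where n = "?m + ?n"]) (use CG in auto)
  also have "\<dots> = det ?A * det (list_mat ys ys S)"
    unfolding NM by (rule det_four_block_mat_lower_left_zero) auto
  finally show ?thesis
    using xs ys disj set_det_list_mat[of "xs @ ys" f]
    by (simp add: list_mat_append set_det_list_mat S_def[abs_def])
qed

lemma set_det_insert_row: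
  fixes f :: "'a \<Rightarrow> 'a \<Rightarrow> 'b::idom"
  assumes fin: "finite J" and y: "y \<notin> J" and 0: "\<And>v. v \<in> J \<Longrightarrow> f y v = 0"
  shows "set_det (insert y J) f = f y y * set_det J f"
proof -
  obtain ys where ys: "set ys = J" "distinct ys"
    using finite_distinct_list[OF fin(1)] by blast
  have *: "list_mat [y] ys f = 0\<^sub>m 1 (length ys)"
    by (rule eq_matI) (use 0 ys in auto)
  have "det (list_mat ([y] @ ys) ([y] @ ys) f) = det (list_mat [y] [y] f) * det (list_mat ys ys f)"
    unfolding list_mat_append
    by (rule det_four_block_mat_upper_right_zero[where n = 1 and m = "length ys"])
       (use * list_mat_carrier[of "[y]" "[y]" f] list_mat_carrier[of ys "[y]" f] in simp_all)
  moreover have "det (list_mat [y] [y] f) = f y y"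
    by (subst det_single) auto
  ultimately show ?thesis
    using ys y set_det_list_mat[of "[y] @ ys" f] by (simp add: set_det_list_mat)
qed

lemma set_det_eq_0_row_sums:
  fixes f :: "'a \<Rightarrow> 'a \<Rightarrow> 'b::field"
  assumes fin: "finite I" and ne: "I \<noteq> {}" and rows: "\<And>u. u \<in> I \<Longrightarrow> (\<Sum>v\<in>I. f u v) = 0"
  shows "set_det I f = 0"
proof -
  obtain xs where xs: "set xs = I" "distinct xs"
    using finite_distinct_list[OF fin] by blast
  have bij: "bij_betw (\<lambda>k. xs ! k) {0..<length xs} (set xs)"
    using bij_betw_nth[OF xs(2), of "{0..<length xs}" "set xs"] by (auto simp: atLeast0LessThan)
  let ?v = "vec (length xs) (\<lambda>_. 1 :: 'b)"
  have "list_mat xs xs f *\<^sub>v ?v = 0\<^sub>v (length xs)"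
  proof (rule eq_vecI, goal_cases)
    case (1 i)
    then have "xs ! i \<in> I" using xs by auto
    then show ?case
      using 1 rows sum.reindex_bij_betw[OF bij, of "f (xs ! i)"] xs by (simp add: scalar_prod_def)
  qed simp
  moreover have "?v \<noteq> 0\<^sub>v (length xs)"
  proof
    assume "?v = 0\<^sub>v (length xs)"
    then have "?v $ 0 = 0\<^sub>v (length xs) $ 0" by simp
    then show False using xs ne by (cases xs) auto
  qed
  ultimately have "det (list_mat xs xs f) = 0"
    by (subst det_0_iff_vec_prod_zero_field[of _ "length xs"]) (auto intro!: exI[of _ ?v])
  then show ?thesis using xs set_det_list_mat[of xs f] by simp
qed

text \<open>
  Multilinearity in the rows: expanding the product of sums in each Leibniz term amounts to choosing
  one summand \<open>p v\<close> for every row \<open>v\<close>.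
\<close>

lemma set_det_sum_rows:
  assumes "finite I" and "\<And>v. v \<in> I \<Longrightarrow> finite (N v)"
  shows "set_det I (\<lambda>v u. \<Sum>e\<in>N v. r v e u) = (\<Sum>p\<in>Pi\<^sub>E I N. set_det I (\<lambda>v u. r v (p v) u))"
proof -
  have "set_det I (\<lambda>v u. \<Sum>e\<in>N v. r v e u) =
      (\<Sum>q | q permutes I. \<Sum>p\<in>Pi\<^sub>E I N. of_int (sign q) * (\<Prod>v\<in>I. r v (p v) (q v)))"
    unfolding set_det_def
    by (intro sum.cong refl, subst prod_sum_PiE) (use assms in \<open>auto simp: sum_distrib_left\<close>)
  then show ?thesis
    unfolding set_det_def by (subst (asm) sum.swap) simp
qed

lemma poly_set_det: "poly (set_det I F) x = set_det I (\<lambda>u v. poly (F u v) x)"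
  by (simp add: set_det_def poly_sum poly_prod poly_of_int)

lemma of_real_set_det: "complex_of_real (set_det I f) = set_det I (\<lambda>u v. complex_of_real (f u v))"
  by (simp add: set_det_def)

lemma set_det_uminus: "set_det I (\<lambda>u v. - f u v) = (-1) ^ card I * set_det I f"
  unfolding set_det_def sum_distrib_left
  by (rule sum.cong[OF refl], subst prod_uminus) (simp add: algebra_simps)

section \<open>The pseudo-determinant of a matrix with vanishing row and column sums\<close>

lemma char_poly_list_mat:
  assumes "distinct xs"
  shows "char_poly (list_mat xs xs f) =
           set_det (set xs) (\<lambda>u v. (if u = v then [:0, 1:] else 0) - [:f u v:])"
proof -
  have "char_poly_matrix (list_mat xs xs f) =
          list_mat xs xs (\<lambda>u v. (if u = v then [:0, 1:] else 0) - [:f u v:])"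
    by (rule eq_matI) (use assms in \<open>auto simp: char_poly_matrix_def nth_eq_iff_index_eq\<close>)
  then show ?thesis
    using set_det_list_mat[OF assms] by (simp add: char_poly_def)
qed

text \<open>
  All rows and columns of \<open>X - f\<close> sum to \<open>X\<close>. Adding all columns to column \<open>y\<close> and then all rows
  to row \<open>y\<close> therefore leaves the border \<open>n X, X, \<dots>, X\<close> in row \<open>y\<close> and \<open>X\<close> in the other entries
  of column \<open>y\<close>, where \<open>n\<close> is the size of the matrix. A factor \<open>X\<close> comes out of column \<open>y\<close>, and
  the remaining matrix at \<open>0\<close> is block triangular with diagonal blocks \<open>n\<close> and \<open>-f\<close> without
  row and column \<open>y\<close>.
\<close>

lemma char_poly_zero_sums:
  fixes f :: "'a \<Rightarrow> 'a \<Rightarrow> complex"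
  assumes dist: "distinct (y # ys)"
    and rows: "\<And>u. u \<in> set (y # ys) \<Longrightarrow> (\<Sum>v\<in>set (y # ys). f u v) = 0"
    and cols: "\<And>v. v \<in> set (y # ys) \<Longrightarrow> (\<Sum>u\<in>set (y # ys). f u v) = 0"
  obtains q where "char_poly (list_mat (y # ys) (y # ys) f) = [:0, 1:] * q"
    and "poly q 0 = of_nat (Suc (length ys)) * ((-1) ^ length ys * set_det (set ys) f)"
proof -
  define J where "J = set ys"
  define I where "I = insert y J"
  have fin: "finite J" "finite I" and y: "y \<notin> J" "y \<in> I" and card: "card J = length ys"
    using dist distinct_card[of ys] by (auto simp: I_def J_def)
  let ?X = "[:0, 1:] :: complex poly"
  define c where "c u v = (if u = v then ?X else 0) - [:f u v:]" for u v
  (* U adds all columns to column y, its transpose adds all rows to row y, and E multiplies column y by X. *)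
  define U where "U u v = (if u = v \<or> v = y then 1 else 0 :: complex poly)" for u v :: 'a
  define E where "E u v = (if u = v then if u = y then ?X else 1 else 0)" for u v :: 'a
  define q where "q u v = (if v = y then if u = y then of_nat (Suc (length ys)) else 1
                           else if u = y then ?X else c u v)" for u v
  have pcons_sum: "(\<Sum>i\<in>A. [:h i:]) = [:\<Sum>i\<in>A. h i:]" for A and h :: "'a \<Rightarrow> complex"
    by (induction A rule: infinite_finite_induct) auto
  have c_row: "(\<Sum>v\<in>I. c u v) = ?X" if "u \<in> I" for u
    using that rows[of u] fin by (simp add: c_def sum_subtractf pcons_sum I_def J_def)
  have c_col: "(\<Sum>u\<in>I. c u v) = ?X" if "v \<in> I" for v
    using that cols[of v] fin by (simp add: c_def sum_subtractf pcons_sum I_def J_def)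
  have "set_det I U = U y y * set_det J U"
    unfolding I_def by (rule set_det_insert_row) (use fin y in \<open>auto simp: U_def\<close>)
  also have "set_det J U = set_det J (\<lambda>u v. if u = v then 1 else 0)"
    by (rule set_det_cong) (use y in \<open>auto simp: U_def\<close>)
  finally have det_U: "set_det I U = 1"
    unfolding set_det_one[OF fin(1)] by (simp add: U_def[of y y])
  have det_UT: "set_det I (\<lambda>u v. U v u) = 1"
    using set_det_transpose[OF fin(2), of U] det_U by simp
  have "set_det I E = E y y * set_det J E"
    unfolding I_def by (rule set_det_insert_row) (use fin y in \<open>auto simp: E_def\<close>)
  also have "set_det J E = set_det J (\<lambda>u v. if u = v then 1 else 0)"
    by (rule set_det_cong) (use y in \<open>auto simp: E_def\<close>)
  finally have det_E: "set_det I E = ?X"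
    unfolding set_det_one[OF fin(1)] by (simp add: E_def[of y y])
  define d where "d u w = (\<Sum>v\<in>I. c u v * U v w)" for u w
  have d: "d u w = (if w = y then ?X else c u w)" if "u \<in> I" "w \<in> I" for u w
  proof (cases "w = y")
    case True
    then show ?thesis using c_row[OF that(1)] by (simp add: d_def U_def)
  next
    case False
    then have "d u w = (\<Sum>v\<in>I. if v = w then c u v else 0)"
      unfolding d_def by (intro sum.cong) (auto simp: U_def)
    then show ?thesis using False fin that by simp
  qed
  have cardI: "card I = Suc (length ys)"
    using fin y by (simp add: I_def card)
  have ud: "(\<Sum>v\<in>I. U v u * d v w) = (\<Sum>v\<in>I. q u v * E v w)" if uw: "u \<in> I" "w \<in> I" for u w
  proof -
    have "(\<Sum>v\<in>I. q u v * E v w) = (\<Sum>v\<in>I. if v = w then q u w * E w w else 0)"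
      by (intro sum.cong) (auto simp: E_def)
    also have "\<dots> = q u w * E w w" using fin uw by simp
    finally have R: "(\<Sum>v\<in>I. q u v * E v w) = q u w * E w w" .
    show ?thesis
    proof (cases "u = y")
      case True
      then have "(\<Sum>v\<in>I. U v u * d v w) = (\<Sum>v\<in>I. if w = y then ?X else c v w)"
        by (intro sum.cong) (use uw d in \<open>auto simp: U_def\<close>)
      also have "\<dots> = (if w = y then of_nat (card I) * ?X else ?X)"
        using c_col[OF uw(2)] by auto
      finally show ?thesis unfolding R using True by (simp add: q_def E_def cardI)
    next
      case False
      then have "(\<Sum>v\<in>I. U v u * d v w) = (\<Sum>v\<in>I. if v = u then d u w else 0)"
        by (intro sum.cong) (auto simp: U_def)
      also have "\<dots> = d u w" using fin uw by simp
      finally show ?thesis unfolding R using False d[OF uw] by (simp add: q_def E_def)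
    qed
  qed
  have "set_det I c = set_det I (\<lambda>u v. U v u) * (set_det I c * set_det I U)"
    by (simp add: det_U det_UT)
  also have "\<dots> = set_det I (\<lambda>u w. \<Sum>v\<in>I. U v u * d v w)"
    by (simp add: set_det_mult[OF fin(2)] d_def)
  also have "\<dots> = set_det I (\<lambda>u w. \<Sum>v\<in>I. q u v * E v w)"
    by (rule set_det_cong) (use ud in auto)
  also have "\<dots> = set_det I q * ?X"
    by (simp add: set_det_mult[OF fin(2), symmetric] det_E)
  finally have "char_poly (list_mat (y # ys) (y # ys) f) = ?X * set_det I q"
    using char_poly_list_mat[OF dist, of f] by (simp add: c_def[abs_def] I_def J_def mult.commute)
  moreover have "poly (set_det I q) 0 = of_nat (Suc (length ys)) * ((-1) ^ length ys * set_det (set ys) f)"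
  proof -
    have "poly (set_det I q) 0 = poly (q y y) 0 * set_det J (\<lambda>u v. poly (q u v) 0)"
      unfolding poly_set_det I_def
      by (rule set_det_insert_row) (use fin y in \<open>auto simp: q_def\<close>)
    also have "set_det J (\<lambda>u v. poly (q u v) 0) = set_det J (\<lambda>u v. - f u v)"
      by (rule set_det_cong) (use y in \<open>auto simp: q_def c_def\<close>)
    also have "poly (q y y) 0 = of_nat (Suc (length ys))"
      by (simp add: q_def)
    finally show ?thesis
      unfolding set_det_uminus card by (simp add: J_def mult.assoc)
  qed
  ultimately show ?thesis using that by blast
qed

text \<open>
  A non-zero principal cofactor makes \<open>0\<close> a simple root of the characteristic polynomial \<open>X q\<close>, so
  the non-zero eigenvalues are exactly the roots of the monic polynomial \<open>q\<close>. Up to sign their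
  product is \<open>q(0)\<close>, and the sign cancels the one in \<open>q(0)\<close>.
\<close>

lemma pseudo_det_zero_sums:
  fixes f :: "'a \<Rightarrow> 'a \<Rightarrow> complex"
  assumes dist: "distinct (y # ys)"
    and rows: "\<And>u. u \<in> set (y # ys) \<Longrightarrow> (\<Sum>v\<in>set (y # ys). f u v) = 0"
    and cols: "\<And>v. v \<in> set (y # ys) \<Longrightarrow> (\<Sum>u\<in>set (y # ys). f u v) = 0"
    and nz: "set_det (set ys) f \<noteq> 0"
  shows "pseudo_det (list_mat (y # ys) (y # ys) f) = of_nat (Suc (length ys)) * set_det (set ys) f"
proof -
  let ?M = "list_mat (y # ys) (y # ys) f"
  obtain q where q: "char_poly ?M = [:0, 1:] * q"
    and q0: "poly q 0 = of_nat (Suc (length ys)) * ((-1) ^ length ys * set_det (set ys) f)"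
    using char_poly_zero_sums[OF dist rows cols] by blast
  have nz0: "poly q 0 \<noteq> 0"
    unfolding q0 using nz by (simp del: of_nat_Suc)
  then have qn: "q \<noteq> 0" by auto
  have dm: "degree (char_poly ?M) = Suc (length ys)" "monic (char_poly ?M)"
    using degree_monic_char_poly[of ?M "Suc (length ys)"] list_mat_carrier[of "y # ys" "y # ys" f]
    by auto
  have deg: "degree q = length ys"
    using dm(1) qn unfolding q by (subst (asm) degree_mult_eq) auto
  have lead: "lead_coeff q = 1"
    using dm(2) unfolding q by (simp only: lead_coeff_mult) simp
  have "proots (char_poly ?M) = {#0#} + proots q"
    unfolding q using qn proots_linear_factor[of "0::complex"] by (subst proots_mult) auto
  moreover have "filter_mset (\<lambda>x. x \<noteq> 0) (proots q) = proots q"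
    using nz0 by (intro filter_mset_eq_conv[THEN iffD2]) (auto simp: set_count_proots[OF qn])
  ultimately have pd: "pseudo_det ?M = (\<Prod>x\<in>#proots q. x)"
    by (simp add: pseudo_det_def)
  have prod_uminus: "(\<Prod>x\<in>#A. - x) = (-1) ^ size A * (\<Prod>x\<in>#A. x)" for A :: "complex multiset"
    by (induction A) auto
  have "poly q 0 = (\<Prod>x\<in>#proots q. - x)"
    by (subst complex_poly_decompose_multiset[symmetric]) (simp add: lead poly_prod_mset)
  also have "\<dots> = (-1) ^ size (proots q) * (\<Prod>x\<in>#proots q. x)"
    by (rule prod_uminus)
  finally have "(-1) ^ length ys * (\<Prod>x\<in>#proots q. x) = poly q 0"
    by (simp add: size_proots_complex deg)
  then have "(-1) ^ length ys * ((-1) ^ length ys * (\<Prod>x\<in>#proots q. x)) = (-1) ^ length ys * poly q 0"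
    by simp
  then show ?thesis
    unfolding pd q0 by (simp add: mult.assoc[symmetric] power_mult_distrib[symmetric] del: of_nat_Suc)
qed

section \<open>Principal minors of the Laplacian count parent maps\<close>

text \<open>
  Iterating \<open>f\<close> leads from every vertex of \<open>I\<close> out of \<open>I\<close>. For finite \<open>I\<close> this says that the
  functional graph of \<open>f\<close> has no cycle inside \<open>I\<close>; the formulation by closed subsets avoids
  iterates and makes the removal of single vertices easy.
\<close>

definition flows_out :: "'a set \<Rightarrow> ('a \<Rightarrow> 'a) \<Rightarrow> bool" where
  "flows_out I f \<longleftrightarrow> (\<forall>S\<subseteq>I. S \<noteq> {} \<longrightarrow> (\<exists>v\<in>S. f v \<notin> S))"

text \<open>
  A forest rooted outside \<open>I\<close> is encoded by the map that sends each vertex of \<open>I\<close> to its parent, the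
  next vertex on the way to the root.
\<close>

definition parent_maps :: "'a rel \<Rightarrow> 'a set \<Rightarrow> ('a \<Rightarrow> 'a) set" where
  "parent_maps E I = {f \<in> Pi\<^sub>E I (\<lambda>v. E `` {v}). flows_out I f}"

definition forest_of :: "'a set \<Rightarrow> 'a set \<Rightarrow> ('a \<Rightarrow> 'a) \<Rightarrow> 'a pair_pre_digraph" where
  "forest_of V I f = \<lparr>pverts = V, parcs = (\<lambda>v. (v, f v)) ` I \<union> (\<lambda>v. (f v, v)) ` I\<rparr>"

lemma flows_out_no_closed_subset:
  assumes "flows_out I f" "S \<subseteq> I" "S \<noteq> {}" "\<And>v. v \<in> S \<Longrightarrow> f v \<in> S"
  shows False
  using assms unfolding flows_out_def by blast

text \<open>
  If some \<open>f v\<close> lies outside \<open>I\<close>, row \<open>v\<close> is a unit vector and \<open>v\<close> can be removed from \<open>I\<close>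
  without changing either side. Otherwise \<open>I\<close> is empty, or it is closed under \<open>f\<close> and all row sums
  vanish.
\<close>

lemma set_det_functional_graph:
  assumes "finite I"
  shows "set_det I (\<lambda>v u. (if u = v then 1 else 0) - (if u = f v then 1 else 0)) =
           (if flows_out I f then 1 else 0 :: 'b::field)"
  using assms
proof (induction I rule: finite_psubset_induct)
  case (psubset I)
  let ?r = "\<lambda>v u. (if u = v then 1 else 0) - (if u = f v then 1 else 0) :: 'b"
  consider "I = {}" | "I \<noteq> {}" "\<forall>v\<in>I. f v \<in> I" | v where "v \<in> I" "f v \<notin> I"
    by blast
  then show ?case
  proof cases
    case 1
    then show ?thesis by (simp add: flows_out_def set_det_def)
  next
    case 2
    then have "set_det I ?r = 0"
      by (intro set_det_eq_0_row_sums) (use psubset.hyps in \<open>auto simp: sum_subtractf\<close>)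
    moreover have "\<not> flows_out I f"
      using 2 by (auto simp: flows_out_def)
    ultimately show ?thesis by simp
  next
    case 3
    let ?J = "I - {v}"
    have I: "I = insert v ?J" using 3 by auto
    have "set_det (insert v ?J) ?r = ?r v v * set_det ?J ?r"
      by (rule set_det_insert_row) (use 3 psubset.hyps in auto)
    moreover have "f v \<noteq> v" using 3 by auto
    ultimately have "set_det I ?r = set_det ?J ?r" using I by simp
    moreover have "flows_out I f \<longleftrightarrow> flows_out ?J f"
    proof
      assume fl: "flows_out ?J f"
      show "flows_out I f"
        unfolding flows_out_def
      proof (intro allI impI)
        fix S assume S: "S \<subseteq> I" "S \<noteq> {}"
        show "\<exists>w\<in>S. f w \<notin> S"
        proof (cases "v \<in> S")
          case True
          then show ?thesis using 3 S by auto
        next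
          case False
          then have "S \<subseteq> ?J" using S by auto
          then show ?thesis using fl S by (auto simp: flows_out_def)
        qed
      qed
    qed (auto simp: flows_out_def)
    moreover have "?J \<subset> I" using 3 by auto
    ultimately show ?thesis using psubset.IH[of ?J] by simp
  qed
qed

lemma out_degree_eq_card: "out_degree (with_proj H) v = card (parcs H `` {v})"
proof -
  have "out_arcs (with_proj H) v = Pair v ` (parcs H `` {v})"
    by (auto simp: out_arcs_def)
  then show ?thesis
    by (simp add: out_degree_def card_image inj_on_def)
qed

text \<open>
  Row \<open>v\<close> of the Laplacian is the sum, over the neighbours \<open>w\<close> of \<open>v\<close>, of the row that a functional
  graph with the arc from \<open>v\<close> to \<open>w\<close> would have.
\<close>

lemma laplacian_eq_sum:
  assumes "pair_graph H"
  shows "laplacian H v u =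
           (\<Sum>w\<in>parcs H `` {v}. (if u = v then 1 else 0) - (if u = w then 1 else 0))"
proof -
  interpret pair_graph H by fact
  have fin: "finite (parcs H `` {v})" using pair_finite_arcs by (rule finite_Image)
  have "(v, v) \<notin> parcs H" using pair_no_loops[of "(v, v)"] by auto
  then show ?thesis
    using fin by (cases "u = v") (auto simp: laplacian_def sum_subtractf sum_negf out_degree_eq_card)
qed

text \<open>
  The matrix-tree theorem for rooted forests, in terms of parent maps: expanding every row over the
  neighbours turns the minor into a sum over all maps that choose a neighbour of each vertex, and
  each of them contributes \<open>1\<close> or \<open>0\<close> according to whether it is a parent map.
\<close>

lemma set_det_laplacian_eq_card_parent_maps:
  assumes H: "pair_graph H" and I: "I \<subseteq> pverts H"
  shows "set_det I (laplacian H) = real (card (parent_maps (parcs H) I))"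
proof -
  interpret pair_graph H by fact
  have fin: "finite I" using I pair_finite_verts finite_subset by blast
  have finN: "finite (parcs H `` {v})" for v using pair_finite_arcs by (rule finite_Image)
  have finP: "finite (Pi\<^sub>E I (\<lambda>v. parcs H `` {v}))"
    using fin finN by (intro finite_PiE) auto
  have "set_det I (laplacian H) =
     (\<Sum>f\<in>Pi\<^sub>E I (\<lambda>v. parcs H `` {v}). if flows_out I f then 1 else 0)"
    unfolding laplacian_eq_sum[OF H, abs_def] set_det_functional_graph[OF fin, symmetric]
    by (rule set_det_sum_rows) (use fin finN in auto)
  also have "\<dots> = real (card (parent_maps (parcs H) I))"
    using finP by (simp add: parent_maps_def Int_def sum.If_cases)
  finally show ?thesis .
qed

text \<open>
  Moving to a neighbour that is closer to the complement of \<open>I\<close> is a parent map: a vertex of a set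
  \<open>S\<close> at minimal distance from that complement is sent out of \<open>S\<close>.
\<close>

lemma ex_parent_map:
  assumes "\<And>v. v \<in> I \<Longrightarrow> \<exists>r. r \<notin> I \<and> (v, r) \<in> E\<^sup>*"
  obtains f where "f \<in> parent_maps E I"
proof -
  define d where "d v = (LEAST n. \<exists>r. r \<notin> I \<and> (v, r) \<in> E ^^ n)" for v
  have "\<exists>w. (v, w) \<in> E \<and> d w < d v" if v: "v \<in> I" for v
  proof -
    have "\<exists>n r. r \<notin> I \<and> (v, r) \<in> E ^^ n"
      using assms[OF v] by (meson rtrancl_imp_relpow)
    then obtain r where r: "r \<notin> I" "(v, r) \<in> E ^^ d v"
      using LeastI_ex[of "\<lambda>n. \<exists>r. r \<notin> I \<and> (v, r) \<in> E ^^ n"] unfolding d_def by blast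
    then obtain m where m: "d v = Suc m" using v by (cases "d v") auto
    then obtain w where w: "(v, w) \<in> E" "(w, r) \<in> E ^^ m"
      using r relpow_Suc_D2 by metis
    have "d w \<le> m" unfolding d_def by (rule Least_le) (use r w in blast)
    then show ?thesis using w m by auto
  qed
  then obtain g where g: "\<And>v. v \<in> I \<Longrightarrow> (v, g v) \<in> E \<and> d (g v) < d v" by metis
  have "restrict g I \<in> parent_maps E I"
    unfolding parent_maps_def flows_out_def
  proof (intro CollectI conjI allI impI)
    fix S assume S: "S \<subseteq> I" "S \<noteq> {}"
    obtain v where v: "v \<in> S" "\<And>w. w \<in> S \<Longrightarrow> d v \<le> d w"
      using S ex_has_least_nat[of "\<lambda>v. v \<in> S" _ d] by blast
    then have "g v \<notin> S" using g[of v] S by force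
    then show "\<exists>v\<in>S. restrict g I v \<notin> S" using v S by (intro bexI[of _ v]) auto
  qed (use g in auto)
  then show ?thesis by (rule that)
qed

lemma flows_out_reaches:
  assumes f: "flows_out I f"
  shows "\<exists>r. r \<notin> I \<and> (v, r) \<in> ((\<lambda>v. (v, f v)) ` I)\<^sup>*"
proof (rule ccontr)
  let ?P = "(\<lambda>v. (v, f v)) ` I"
  define S where "S = {v \<in> I. \<not> (\<exists>r. r \<notin> I \<and> (v, r) \<in> ?P\<^sup>*)}"
  assume "\<not> ?thesis"
  then have "v \<in> S" by (auto simp: S_def)
  moreover have "S \<subseteq> I" by (simp add: S_def)
  ultimately obtain w where w: "w \<in> S" "f w \<notin> S"
    using f[unfolded flows_out_def, rule_format, of S] by blast
  then have wI: "(w, f w) \<in> ?P" by (auto simp: S_def)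
  have "\<exists>r. r \<notin> I \<and> (f w, r) \<in> ?P\<^sup>*"
    using w by (auto simp: S_def)
  then have "\<exists>r. r \<notin> I \<and> (w, r) \<in> ?P\<^sup>*"
    using wI by (meson converse_rtrancl_into_rtrancl)
  then show False using w by (auto simp: S_def)
qed

section \<open>Rooted spanning forests correspond to parent maps\<close>

text \<open>
  A cycle as a periodic sequence of vertices, so that neighbours along the cycle are reached by
  successors without a special case at the end of the walk.
\<close>

lemma cycle_enumeration:
  assumes wf: "pair_wf_digraph F" and p: "pre_digraph.cycle (with_proj F) p"
  obtains x :: "nat \<Rightarrow> 'a" where "\<And>i. (x i, x (Suc i)) \<in> parcs F"
    and "\<And>i j. x i = x j \<longleftrightarrow> i mod length p = j mod length p"
proof -
  interpret pair_wf_digraph F by fact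
  obtain u where u: "awalk u p u" "distinct (tl (pawalk_verts u p))" "p \<noteq> []"
    using p by (auto simp: cycle_def)
  let ?n = "length p"
  have n: "?n > 0" using u by simp
  have cas: "pcas u p u" and sub: "set p \<subseteq> parcs F" using u(1) by (auto simp: awalk_def)
  have verts: "pawalk_verts u p = fst (hd p) # map snd p"
    using awalk_verts_conv'[OF cas] u(3) by simp
  have "map fst p @ [snd (last p)] = fst (hd p) # map snd p"
    using awalk_verts_conv[of u p] verts u(3) by simp
  then have nth: "(map fst p @ [snd (last p)]) ! k = (fst (hd p) # map snd p) ! k" for k
    by simp
  have step: "fst (p ! Suc i) = snd (p ! i)" if "Suc i < ?n" for i
    using nth[of "Suc i"] that by (simp add: nth_append)
  have "hd (pawalk_verts u p) = u" "last (pawalk_verts u p) = u"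
    using awhd_of_awalk[OF u(1)] awlast_if_cas[OF cas] by simp_all
  then have closed: "fst (p ! 0) = snd (p ! (?n - 1))"
    unfolding verts using u(3) by (simp add: hd_conv_nth last_map last_conv_nth)
  define x where "x i = snd (p ! (i mod ?n))" for i
  have "(x i, x (Suc i)) \<in> parcs F" for i
  proof -
    have "fst (p ! (Suc i mod ?n)) = x i"
    proof (cases "Suc (i mod ?n) = ?n")
      case True
      then have "Suc i mod ?n = 0" "i mod ?n = ?n - 1"
        by (auto simp: mod_Suc)
      then show ?thesis using closed by (simp add: x_def)
    next
      case False
      then have "Suc i mod ?n = Suc (i mod ?n)" "Suc (i mod ?n) < ?n"
        using n mod_less_divisor[OF n, of i] by (auto simp: mod_Suc simp del: mod_less_divisor)
      then show ?thesis using step by (simp add: x_def)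
    qed
    then have "(x i, x (Suc i)) = p ! (Suc i mod ?n)"
      by (simp add: x_def prod_eq_iff)
    then show ?thesis using sub n by (metis mod_less_divisor nth_mem subsetD)
  qed
  moreover have "x i = x j \<longleftrightarrow> i mod ?n = j mod ?n" for i j
  proof -
    have "distinct (map snd p)" using u(2) verts by simp
    from nth_eq_iff_index_eq[OF this, of "i mod ?n" "j mod ?n"] n
    show ?thesis by (simp add: x_def)
  qed
  ultimately show ?thesis by (rule that)
qed

text \<open>
  A path from \<open>u\<close> to \<open>w\<close> that avoids the edge has at least two arcs, so the edge closes it to a
  cycle of length at least three.
\<close>

lemma forest_edge_is_bridge:
  assumes F: "undirected_forest F" and e: "(u, w) \<in> parcs F"
  shows "(u, w) \<notin> (parcs F - {(u, w), (w, u)})\<^sup>*"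
proof
  assume path: "(u, w) \<in> (parcs F - {(u, w), (w, u)})\<^sup>*"
  interpret pair_graph F using F by (simp add: undirected_forest_def)
  define F' where "F' = F\<lparr>parcs := parcs F - {(u, w), (w, u)}\<rparr>"
  have F'_sel: "parcs F' = parcs F - {(u, w), (w, u)}" "pverts F' = pverts F"
    by (simp_all add: F'_def)
  interpret F': pair_wf_digraph F'
    by unfold_locales (auto simp: F'_sel intro: in_arcsD1 in_arcsD2)
  have V: "u \<in> pverts F" "w \<in> pverts F" using e in_arcsD1 in_arcsD2 by auto
  have ne: "u \<noteq> w" using e no_loops' by auto
  have "u \<rightarrow>\<^sup>*\<^bsub>with_proj F'\<^esub> w"
    unfolding F'.reachable_conv using path V by (simp add: F'_sel)
  then obtain p where p: "F'.apath u p w"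
    using F'.reachable_apath by blast
  have aw': "F'.awalk u p w" and dist: "distinct (pawalk_verts u p)"
    using p by (auto simp: F'.apath_def)
  have aw: "awalk u p w"
    using aw' by (auto simp: F'.awalk_def awalk_def F'_sel)
  have "p \<noteq> []" using aw ne by auto
  moreover have "p \<noteq> [e]" for e
    using aw' by (auto simp: F'.awalk_def F'_sel)
  ultimately have len: "length p \<ge> 2"
    by (cases p rule: list.exhaust[case_product list.exhaust]) (auto, metis One_nat_def le_add1 length_0_conv length_Suc_conv not_less_eq_eq plus_1_eq_Suc numeral_2_eq_2 neq_Nil_conv)
  have "(w, u) \<in> parcs F" using e arcs_symmetric by auto
  then have "awalk u (p @ [(w, u)]) u"
    by (intro awalk_appendI[OF aw]) (auto simp: awalk_simps V)
  moreover have "distinct (tl (pawalk_verts u (p @ [(w, u)])))"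
  proof -
    have "pawalk_verts u (p @ [(w, u)]) = pawalk_verts u p @ [u]"
      using awalk_verts_append[OF calculation] aw by auto
    moreover have "pawalk_verts u p = u # tl (pawalk_verts u p)"
      by (metis aw awalkE' list.collapse awalk_verts_non_Nil)
    ultimately show ?thesis
      using dist by (metis distinct1_rotate list.sel(3) rotate1.simps(2) append_Cons)
  qed
  ultimately have "cycle (p @ [(w, u)])"
    by (auto simp: cycle_def)
  then show False using F len unfolding undirected_forest_def by fastforce
qed

text \<open>
  In the graph of a parent map each arc of a cycle is traversed either towards the parent or away
  from it. After a step away from a parent the next step cannot return, because two steps
  along a cycle of length at least three never end where they started, so it is again away from a
  parent. Hence all steps have the same direction, and the vertices of the cycle form a non-empty
  subset of \<open>I\<close> that is closed under \<open>f\<close>.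
\<close>

lemma flows_out_no_cycle:
  assumes f: "flows_out I f"
    and arc: "\<And>i. (x i \<in> I \<and> x (Suc i) = f (x i)) \<or> (x (Suc i) \<in> I \<and> x i = f (x (Suc i)))"
    and per: "\<And>i j. x i = x j \<longleftrightarrow> i mod n = j mod n" and n: "3 \<le> n"
  shows False
proof (cases "\<exists>k. x (Suc k) \<in> I \<and> x k = f (x (Suc k))")
  case True
  then obtain k where k: "x (Suc k) \<in> I" "x k = f (x (Suc k))" by blast
  have bwd: "x (Suc (k + i)) \<in> I \<and> x (k + i) = f (x (Suc (k + i)))" for i
  proof (induction i)
    case (Suc i)
    have "x (Suc (Suc (k + i))) \<noteq> x (k + i)"
    proof
      assume "x (Suc (Suc (k + i))) = x (k + i)"
      then have "(k + i + 2) mod n = (k + i) mod n" using per by simp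
      then have "n dvd 2"
        using mod_eq_dvd_iff_nat[of "k + i" "k + i + 2" n] by simp
      then show False using n by (auto dest: dvd_imp_le)
    qed
    then show ?case using arc[of "Suc (k + i)"] Suc by auto
  qed (use k in simp)
  (* By periodicity the tail of the sequence is the vertex set of the whole cycle. *)
  let ?S = "range (\<lambda>i. x (Suc (k + i)))"
  have "?S \<subseteq> I" using bwd by auto
  moreover have "f v \<in> ?S" if "v \<in> ?S" for v
  proof -
    from that obtain i where i: "v = x (Suc (k + i))" by blast
    then have "f v = x (k + i)" using bwd[of i] by simp
    also have "\<dots> = x (Suc (k + (i + (n - 1))))"
      using per n by (simp add: add.assoc[symmetric])
    finally show ?thesis by blast
  qed
  ultimately show False by (intro flows_out_no_closed_subset[OF f, of ?S]) auto
next
  case False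
  then have fwd: "x i \<in> I \<and> x (Suc i) = f (x i)" for i using arc[of i] by blast
  then have "range x \<subseteq> I" by auto
  moreover have "f v \<in> range x" if "v \<in> range x" for v
    using that fwd by (metis rangeE rangeI)
  ultimately show False by (intro flows_out_no_closed_subset[OF f, of "range x"]) auto
qed

text \<open>
  The forests counted by \<^const>\<open>num_rooted_spanning_forests\<close> for \<open>R \<subseteq> pverts H\<close>, with components
  replaced by reachability along arcs.
\<close>

definition rooted_forests :: "'a pair_pre_digraph \<Rightarrow> 'a set \<Rightarrow> 'a pair_pre_digraph set" where
  "rooted_forests H R = {F. undirected_forest F \<and> spanning (with_proj F) (with_proj H) \<and>
     (\<forall>v\<in>pverts H. \<exists>!r. r \<in> R \<and> (v, r) \<in> (parcs F)\<^sup>*)}"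

lemma spanning_with_proj_iff:
  assumes "pair_graph F" "pair_graph H"
  shows "spanning (with_proj F) (with_proj H) \<longleftrightarrow> pverts F = pverts H \<and> parcs F \<subseteq> parcs H"
proof -
  interpret F: pair_graph F by fact
  interpret H: pair_graph H by fact
  show ?thesis
    using F.wf_digraph H.wf_digraph by (auto simp: spanning_def subgraph_def compatibleI_with_proj)
qed

text \<open>
  Absence of cycles is \<open>flows_out_no_cycle\<close>. Parent arcs lead every vertex to some root, and the root
  is unique because the roots reachable by parent arcs are the same at both ends of an edge, while no
  parent arc starts at a root.
\<close>

lemma forest_of_in_rooted_forests:
  assumes H: "pair_graph H" and R: "R \<subseteq> pverts H" 
    and f: "f \<in> parent_maps (parcs H) (pverts H - R)"
  shows "forest_of (pverts H) (pverts H - R) f \<in> rooted_forests H R"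
proof -
  interpret pair_graph H by fact
  define I where "I = pverts H - R"
  define F where "F = forest_of (pverts H) I f"
  let ?P = "(\<lambda>v. (v, f v)) ` I"
  have fl: "flows_out I f" and fE: "\<And>v. v \<in> I \<Longrightarrow> (v, f v) \<in> parcs H"
    using f by (auto simp: parent_maps_def I_def)
  have E: "parcs F = ?P \<union> ?P\<inverse>" and V: "pverts F = pverts H"
    by (auto simp: F_def forest_of_def)
  have sub: "parcs F \<subseteq> parcs H"
    unfolding E using fE arcs_symmetric by auto
  have "a \<in> pverts H \<and> b \<in> pverts H \<and> a \<noteq> b" if "(a, b) \<in> parcs F" for a b
    using subsetD[OF sub that] in_arcsD1[of a b] in_arcsD2[of a b] no_loops'[of a b] by simp
  note ab = this
  have F: "pair_graph F"
  proof
    show "finite (parcs F)" using sub pair_finite_arcs finite_subset by blast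
    show "symmetric (with_proj F)" by (auto simp: symmetric_def E sym_def)
  qed (use ab V pair_finite_verts in auto)
  interpret F: pair_graph F by fact
  have "undirected_forest F"
    unfolding undirected_forest_def
  proof (intro conjI notI F)
    assume "\<exists>p. F.cycle p \<and> 3 \<le> length p"
    then obtain p where p: "F.cycle p" "3 \<le> length p" by blast
    have "pair_wf_digraph F" ..
    from this p(1) obtain x where x: "\<And>i. (x i, x (Suc i)) \<in> parcs F"
        "\<And>i j. x i = x j \<longleftrightarrow> i mod length p = j mod length p"
      by (rule cycle_enumeration) blast
    show False
      by (rule flows_out_no_cycle[OF fl _ x(2) p(2)]) (use x(1) in \<open>auto simp: E\<close>)
  qed
  moreover have "spanning (with_proj F) (with_proj H)"
    using spanning_with_proj_iff[OF F H] V sub by simp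
  moreover have "\<exists>!r. r \<in> R \<and> (v, r) \<in> (parcs F)\<^sup>*" if v: "v \<in> pverts H" for v
  proof -
    have P_root: "b = r" if "(b, r) \<in> ?P\<^sup>*" "b \<in> R" for b r
      using that by (cases rule: converse_rtranclE) (auto simp: I_def)
    (* Along an edge of the forest the set of roots that the parent map leads to does not change. *)
    have inv: "(a, r) \<in> ?P\<^sup>* \<longleftrightarrow> (b, r) \<in> ?P\<^sup>*" if "(a, b) \<in> (parcs F)\<^sup>*" "r \<in> R" for a b r
      using that(1)
    proof induction
      case (step b c)
      have *: "(b, r) \<in> ?P\<^sup>* \<longleftrightarrow> (c, r) \<in> ?P\<^sup>*" if bc: "(b, c) \<in> ?P" for b c
      proof
        assume "(b, r) \<in> ?P\<^sup>*"
        then show "(c, r) \<in> ?P\<^sup>*"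
        proof (cases rule: converse_rtranclE)
          case base
          then show ?thesis using bc \<open>r \<in> R\<close> by (auto simp: I_def)
        next
          case (step z)
          then show ?thesis using bc by auto
        qed
      qed (use bc in \<open>meson converse_rtrancl_into_rtrancl\<close>)
      show ?case using step *[of b c] *[of c b] unfolding E by blast
    qed simp
    obtain r where r: "r \<notin> I" "(v, r) \<in> ?P\<^sup>*"
      using flows_out_reaches[OF fl] by blast
    have rF: "(v, r) \<in> (parcs F)\<^sup>*"
      using r(2) rtrancl_mono[of ?P "parcs F"] E by auto
    have "r \<in> pverts H"
      using rF v by (induction rule: rtrancl_induct) (use F.in_arcsD2 V in auto)
    then have "r \<in> R" using r by (auto simp: I_def)
    moreover have "r' = r" if r': "r' \<in> R" "(v, r') \<in> (parcs F)\<^sup>*" for r'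
    proof -
      have "(r', r) \<in> ?P\<^sup>*" using inv[OF r'(2) \<open>r \<in> R\<close>] r(2) by simp
      then show ?thesis using P_root r'(1) by blast
    qed
    ultimately show ?thesis using rF by blast
  qed
  ultimately show ?thesis by (simp add: rooted_forests_def F_def I_def)
qed

text \<open>
  If the parents of \<open>v\<close> under \<open>f\<close> and \<open>g\<close> differ, the edge from \<open>v\<close> to \<open>g v\<close> must come from
  \<open>f (g v) = v\<close>. Then \<open>f\<close> and \<open>g\<close> differ at \<open>g v\<close> as well, since \<open>g (g v) = v\<close> would be a
  \<open>2\<close>-cycle of \<open>g\<close>. So the set where \<open>f\<close> and \<open>g\<close> differ is closed under \<open>g\<close>.
\<close>

lemma forest_of_inj:
  assumes f: "f \<in> parent_maps E I" and g: "g \<in> parent_maps E I"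
    and eq: "forest_of V I f = forest_of V I g"
  shows "f = g"
proof (rule ccontr)
  assume "f \<noteq> g"
  have ext: "f \<in> extensional I" "g \<in> extensional I" and fl: "flows_out I g"
    using f g by (auto simp: parent_maps_def PiE_def)
  let ?S = "{v \<in> I. f v \<noteq> g v}"
  have "?S \<noteq> {}" using \<open>f \<noteq> g\<close> ext extensionalityI by blast
  have arcs: "(\<lambda>v. (v, f v)) ` I \<union> (\<lambda>v. (f v, v)) ` I = (\<lambda>v. (v, g v)) ` I \<union> (\<lambda>v. (g v, v)) ` I"
    using eq by (simp add: forest_of_def)
  have "g v \<in> ?S" if v: "v \<in> ?S" for v
  proof -
    have "(v, g v) \<in> (\<lambda>v. (v, f v)) ` I \<union> (\<lambda>v. (f v, v)) ` I"
      unfolding arcs using v by auto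
    then obtain z where z: "z \<in> I" "(v, g v) = (z, f z) \<or> (v, g v) = (f z, z)" by blast
    have "f v \<noteq> g v" using v by simp
    with z have "g v = z" "f z = v" by auto
    with z have w: "g v \<in> I" "f (g v) = v" by simp_all
    have "g (g v) \<noteq> v"
    proof
      assume "g (g v) = v"
      then show False
        using v w(1) by (intro flows_out_no_closed_subset[OF fl, of "{v, g v}"]) auto
    qed
    then show ?thesis using w by auto
  qed
  with \<open>?S \<noteq> {}\<close> show False by (intro flows_out_no_closed_subset[OF fl, of ?S]) auto
qed

text \<open>
  Inside the forest choose a parent map towards the roots. The two ends of any other edge would be
  joined to the same root by parent arcs, hence to each other, although every edge of a forest is a
  bridge.
\<close>

lemma rooted_forest_is_forest_of:
  assumes H: "pair_graph H" and F: "F \<in> rooted_forests H R"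
  obtains f where "f \<in> parent_maps (parcs H) (pverts H - R)"
    and "F = forest_of (pverts H) (pverts H - R) f"
proof -
  define I where "I = pverts H - R"
  have ff: "undirected_forest F" and sp: "spanning (with_proj F) (with_proj H)"
    and root: "\<And>v. v \<in> pverts H \<Longrightarrow> \<exists>!r. r \<in> R \<and> (v, r) \<in> (parcs F)\<^sup>*"
    using F by (simp_all add: rooted_forests_def)
  have "pair_graph F" using ff by (simp add: undirected_forest_def)
  then interpret F: pair_graph F .
  have V: "pverts F = pverts H" and sub: "parcs F \<subseteq> parcs H"
    using sp spanning_with_proj_iff[OF \<open>pair_graph F\<close> H] by auto
  have "\<exists>r. r \<notin> I \<and> (v, r) \<in> (parcs F)\<^sup>*" if "v \<in> I" for v
    using root[of v] that by (auto simp: I_def)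
  then obtain f where f: "f \<in> parent_maps (parcs F) I"
    using ex_parent_map by blast
  let ?P = "(\<lambda>v. (v, f v)) ` I"
  have fl: "flows_out I f" and fE: "\<And>v. v \<in> I \<Longrightarrow> (v, f v) \<in> parcs F"
    using f by (auto simp: parent_maps_def)
  have PF: "?P \<union> ?P\<inverse> \<subseteq> parcs F" using fE F.arcs_symmetric by auto
  have root_P: "\<exists>r. r \<in> R \<and> (v, r) \<in> ?P\<^sup>*" if "v \<in> pverts H" for v
  proof -
    obtain r where r: "r \<notin> I" "(v, r) \<in> ?P\<^sup>*"
      using flows_out_reaches[OF fl] by blast
    have "r \<in> pverts H"
      using r(2) that by (induction rule: rtrancl_induct) (use fE F.in_arcsD2 V in auto)
    then show ?thesis using r by (auto simp: I_def)
  qed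
  have PFs: "?P\<^sup>* \<subseteq> (parcs F)\<^sup>*" using PF by (intro rtrancl_mono) auto
  have "parcs F \<subseteq> ?P \<union> ?P\<inverse>"
  proof (rule ccontr)
    assume "\<not> ?thesis"
    then obtain u w where uw: "(u, w) \<in> parcs F" "(u, w) \<notin> ?P \<union> ?P\<inverse>" by auto
    have uV: "u \<in> pverts H" "w \<in> pverts H" using uw F.in_arcsD1 F.in_arcsD2 V by auto
    obtain r s where r: "r \<in> R" "(u, r) \<in> ?P\<^sup>*" and s: "s \<in> R" "(w, s) \<in> ?P\<^sup>*"
      using root_P uV by blast
    have "(u, s) \<in> (parcs F)\<^sup>*" 
      using uw(1) s(2) PFs by (meson converse_rtrancl_into_rtrancl subsetD)
    then have "r = s" using root[OF uV(1)] r s PFs by blast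
    let ?E = "parcs F - {(u, w), (w, u)}"
    have E: "?P \<union> ?P\<inverse> \<subseteq> ?E" using PF uw(2) by auto
    have "?P\<^sup>* \<subseteq> ?E\<^sup>*" "(?P\<inverse>)\<^sup>* \<subseteq> ?E\<^sup>*"
      using E by (auto intro!: rtrancl_mono)
    moreover have "(s, w) \<in> (?P\<inverse>)\<^sup>*" using s(2) by (simp add: rtrancl_converse)
    ultimately have "(u, w) \<in> ?E\<^sup>*"
      using r(2) \<open>r = s\<close> by (meson rtrancl_trans subsetD)
    then show False using forest_edge_is_bridge[OF ff uw(1)] by simp
  qed
  then have "F = forest_of (pverts H) I f"
    using PF V by (intro pair_pre_digraph.equality) (auto simp: forest_of_def)
  moreover have "f \<in> parent_maps (parcs H) I"
    using f sub by (auto simp: parent_maps_def PiE_def Pi_def)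
  ultimately show ?thesis using that by (simp add: I_def)
qed

lemma card_rooted_forests:
  assumes H: "pair_graph H" and R: "R \<subseteq> pverts H"
  shows "card (rooted_forests H R) = card (parent_maps (parcs H) (pverts H - R))"
proof (rule bij_betw_same_card[symmetric], unfold bij_betw_def, intro conjI)
  show "inj_on (forest_of (pverts H) (pverts H - R)) (parent_maps (parcs H) (pverts H - R))"
    by (rule inj_onI) (rule forest_of_inj)
  show "forest_of (pverts H) (pverts H - R) ` parent_maps (parcs H) (pverts H - R) = rooted_forests H R"
    using forest_of_in_rooted_forests[OF H R] rooted_forest_is_forest_of[OF H] by blast
qed

text \<open>
  If each component contains exactly one root, assigning components to roots is a bijection, so the
  number of components takes care of itself.
\<close>

lemma sccs_one_root_iff:
  assumes F: "pair_graph F" and R: "R \<subseteq> pverts F"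
  shows "card (pre_digraph.sccs_verts (with_proj F)) = card R \<and>
           (\<forall>C\<in>pre_digraph.sccs_verts (with_proj F). \<exists>!r. r \<in> C \<and> r \<in> R) \<longleftrightarrow>
         (\<forall>v\<in>pverts F. \<exists>!r. r \<in> R \<and> (v, r) \<in> (parcs F)\<^sup>*)"
proof -
  interpret pair_graph F by fact
  have scc: "scc_of v = {w \<in> pverts F. (v, w) \<in> (parcs F)\<^sup>*}" if "v \<in> pverts F" for v
    using that symmetric_reachable' by (auto simp: scc_of_def reachable_conv)
  have roots: "(\<forall>C\<in>sccs_verts. \<exists>!r. r \<in> C \<and> r \<in> R) \<longleftrightarrow>
                 (\<forall>v\<in>pverts F. \<exists>!r. r \<in> R \<and> (v, r) \<in> (parcs F)\<^sup>*)"
  proof -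
    have "r \<in> scc_of v \<and> r \<in> R \<longleftrightarrow> r \<in> R \<and> (v, r) \<in> (parcs F)\<^sup>*" if "v \<in> pverts F" for v r
      using scc[OF that] R by auto
    then show ?thesis by (simp add: sccs_verts_conv_scc_of)
  qed
  have card_eq: "card sccs_verts = card R" if ex1: "\<forall>C\<in>sccs_verts. \<exists>!r. r \<in> C \<and> r \<in> R"
  proof -
    have "inj_on scc_of R"
    proof (rule inj_onI)
      fix r s assume rs: "r \<in> R" "s \<in> R" "scc_of r = scc_of s"
      have "r \<in> scc_of r" "s \<in> scc_of r" "scc_of r \<in> sccs_verts"
        using rs R in_scc_of_self scc_of_in_sccs_verts by auto
      then show "r = s" using ex1 rs by blast
    qed
    moreover have "scc_of ` R = sccs_verts"
    proof
      show "scc_of ` R \<subseteq> sccs_verts" using R scc_of_in_sccs_verts by auto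
      show "sccs_verts \<subseteq> scc_of ` R"
      proof
        fix C assume C: "C \<in> sccs_verts"
        then obtain v where v: "C = scc_of v" by (auto simp: sccs_verts_conv_scc_of)
        obtain r where "r \<in> C" "r \<in> R" using ex1 C by blast
        then show "C \<in> scc_of ` R" using v scc_of_eq by blast
      qed
    qed
    ultimately show ?thesis using card_image by metis
  qed
  show ?thesis
    unfolding roots[symmetric] by (rule iffI, erule conjunct2, rule conjI, rule card_eq, assumption+)
qed

lemma num_rooted_spanning_forests_eq:
  assumes H: "pair_graph H" and R: "R \<subseteq> pverts H"
  shows "num_rooted_spanning_forests H R = card (rooted_forests H R)"
proof -
  have "undirected_forest F \<and> spanning (with_proj F) (with_proj H) \<and>
          card (pre_digraph.sccs_verts (with_proj F)) = card R \<and>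
          (\<forall>C \<in> pre_digraph.sccs_verts (with_proj F). \<exists>!r. r \<in> C \<and> r \<in> R)
        \<longleftrightarrow> F \<in> rooted_forests H R" for F
  proof (cases "undirected_forest F \<and> spanning (with_proj F) (with_proj H)")
    case True
    then have "pair_graph F" "pverts F = pverts H"
      by (auto simp: undirected_forest_def spanning_def)
    then show ?thesis
      using True sccs_one_root_iff[of F R] R by (simp add: rooted_forests_def)
  qed (auto simp: rooted_forests_def)
  then show ?thesis by (simp add: num_rooted_spanning_forests_def)
qed

text \<open>
  A forest is connected exactly if every vertex reaches a given vertex \<open>y\<close>.
\<close>

lemma num_spanning_trees_eq:
  assumes H: "pair_graph H" and y: "y \<in> pverts H"
  shows "num_spanning_trees H = card (rooted_forests H {y})"
proof -
  have "undirected_tree T \<and> spanning (with_proj T) (with_proj H) \<longleftrightarrow> T \<in> rooted_forests H {y}" for T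
  proof (cases "undirected_forest T \<and> spanning (with_proj T) (with_proj H)")
    case True
    then have T: "pair_graph T" "pverts T = pverts H"
      by (auto simp: undirected_forest_def spanning_def)
    interpret T: pair_graph T by fact
    have "Digraph_Component.connected (with_proj T) \<longleftrightarrow> (\<forall>v\<in>pverts H. (v, y) \<in> (parcs T)\<^sup>*)"
    proof
      assume "Digraph_Component.connected (with_proj T)"
      then have "strongly_connected (with_proj T)"
        by (rule T.symmetric_connected_imp_strongly_connected[OF T.sym_arcs])
      then show "\<forall>v\<in>pverts H. (v, y) \<in> (parcs T)\<^sup>*"
        using y T by (auto simp: strongly_connected_def T.reachable_conv)
    next
      assume *: "\<forall>v\<in>pverts H. (v, y) \<in> (parcs T)\<^sup>*"
      have to_y: "v \<rightarrow>\<^sup>*\<^bsub>with_proj T\<^esub> y" if "v \<in> pverts T" for v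
        using * that y T by (auto simp: T.reachable_conv)
      have "v \<rightarrow>\<^sup>*\<^bsub>with_proj T\<^esub> w" if "v \<in> pverts T" "w \<in> pverts T" for v w
        using to_y[OF that(1)] to_y[OF that(2)] T.symmetric_reachable' T.reachable_trans by blast
      then show "Digraph_Component.connected (with_proj T)"
        unfolding Digraph_Component.connected_def
        by (intro strongly_connectedI) (use y T in \<open>auto intro: T.reachable_mk_symmetricI\<close>)
    qed
    then show ?thesis using True by (auto simp: rooted_forests_def undirected_tree_def)
  qed (auto simp: rooted_forests_def undirected_tree_def)
  then show ?thesis by (simp add: num_spanning_trees_def)
qed

section \<open>The Dirichlet-to-Neumann map as a Schur complement\<close>

lemma laplacian_sym: "pair_graph H \<Longrightarrow> laplacian H u v = laplacian H v u"
  using pair_sym_digraph.arcs_symmetric[of H]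
  by (auto simp: laplacian_def pair_graph_def pair_pseudo_graph_def)

lemma laplacian_row_sum:
  assumes H: "pair_graph H" and u: "u \<in> pverts H"
  shows "(\<Sum>v\<in>pverts H. laplacian H u v) = 0"
proof -
  interpret pair_graph H by fact
  have "(\<Sum>v\<in>pverts H. laplacian H u v) =
    (\<Sum>w\<in>parcs H `` {u}. \<Sum>v\<in>pverts H. (if v = u then 1 else 0) - (if v = w then 1 else 0))"
    unfolding laplacian_eq_sum[OF H] by (rule sum.swap)
  also have "\<dots> = 0"
    by (intro sum.neutral) (use u pair_finite_verts in_arcsD2 in \<open>auto simp: sum_subtractf\<close>)
  finally show ?thesis .
qed

text \<open>
  The minor counts parent maps, and reachability of the complement of \<open>I\<close> provides at least one.
\<close>

lemma laplacian_minor_pos: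
  assumes H: "pair_graph H" and I: "I \<subseteq> pverts H"
    and reach: "\<And>v. v \<in> I \<Longrightarrow> \<exists>r. r \<notin> I \<and> (v, r) \<in> (parcs H)\<^sup>*"
  shows "set_det I (laplacian H) > 0"
proof -
  interpret pair_graph H by fact
  have "finite (Pi\<^sub>E I (\<lambda>v. parcs H `` {v}))"
    using I pair_finite_verts finite_subset finite_Image[OF pair_finite_arcs]
    by (intro finite_PiE) blast+
  then have "finite (parent_maps (parcs H) I)"
    by (rule rev_finite_subset) (auto simp: parent_maps_def)
  moreover have "parent_maps (parcs H) I \<noteq> {}"
    using ex_parent_map[OF reach] by blast
  ultimately show ?thesis
    using set_det_laplacian_eq_card_parent_maps[OF H I] by (simp add: card_gt_0_iff)
qed

lemma connected_rtrancl:
  assumes H: "pair_graph H" "Digraph_Component.connected (with_proj H)"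
    and uv: "u \<in> pverts H" "v \<in> pverts H"
  shows "(u, v) \<in> (parcs H)\<^sup>*"
proof -
  interpret pair_graph H by fact
  have "strongly_connected (with_proj H)"
    by (rule symmetric_connected_imp_strongly_connected[OF sym_arcs H(2)])
  then show ?thesis using uv by (auto simp: strongly_connected_def reachable_conv)
qed

text \<open>
  Here \<open>g\<close> stands for the inverse of the block of \<open>f\<close> indexed by \<open>I\<close>.
\<close>

definition Schur_complement ::
  "'a set \<Rightarrow> ('a \<Rightarrow> 'a \<Rightarrow> 'b) \<Rightarrow> ('a \<Rightarrow> 'a \<Rightarrow> 'b) \<Rightarrow> 'a \<Rightarrow> 'a \<Rightarrow> 'b::comm_ring_1" where
  "Schur_complement I g f u v = f u v - (\<Sum>b\<in>I. (\<Sum>a\<in>I. f u a * g a b) * f b v)"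

lemma mat_inverse_list_mat:
  fixes f :: "'a \<Rightarrow> 'a \<Rightarrow> 'b::field"
  assumes xs: "distinct xs" and det: "set_det (set xs) f \<noteq> 0"
  obtains g where "mat_inverse (list_mat xs xs f) = Some (list_mat xs xs g)"
    and "\<And>a c. a \<in> set xs \<Longrightarrow> c \<in> set xs \<Longrightarrow> (\<Sum>b\<in>set xs. g a b * f b c) = (if a = c then 1 else 0)"
    and "\<And>a c. a \<in> set xs \<Longrightarrow> c \<in> set xs \<Longrightarrow> (\<Sum>b\<in>set xs. f a b * g b c) = (if a = c then 1 else 0)"
proof -
  let ?n = "length xs" and ?A = "list_mat xs xs f"
  have A: "?A \<in> carrier_mat ?n ?n" by simp
  have "det ?A \<noteq> 0" using det set_det_list_mat[OF xs, of f] by simp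
  then have "mat_inverse ?A \<noteq> None"
    using mat_inverse(1)[OF A, where b = "()"] det_non_zero_imp_unit[OF A, where b = "()"] by blast
  then obtain B where B: "mat_inverse ?A = Some B" by blast
  have inv: "?A * B = 1\<^sub>m ?n" "B * ?A = 1\<^sub>m ?n" "B \<in> carrier_mat ?n ?n"
    using mat_inverse(2)[OF A B] by auto
  define idx where "idx = the_inv_into {..<?n} ((!) xs)"
  have idx: "idx (xs ! i) = i" if "i < ?n" for i
    unfolding idx_def using that xs
    by (intro the_inv_into_f_f) (auto simp: inj_on_def nth_eq_iff_index_eq)
  define g where "g a b = B $$ (idx a, idx b)" for a b
  have Bg: "B = list_mat xs xs g"
    by (rule eq_matI) (use inv(3) idx in \<open>auto simp: g_def\<close>)
  have entries: "h a c = (if a = c then 1 else 0)"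
    if "list_mat xs xs h = 1\<^sub>m ?n" "a \<in> set xs" "c \<in> set xs" for h :: "'a \<Rightarrow> 'a \<Rightarrow> 'b" and a c
  proof -
    obtain i j where ij: "i < ?n" "a = xs ! i" "j < ?n" "c = xs ! j"
      using \<open>a \<in> set xs\<close> \<open>c \<in> set xs\<close> by (auto simp: in_set_conv_nth)
    have "list_mat xs xs h $$ (i, j) = 1\<^sub>m ?n $$ (i, j)" using that(1) by simp
    then show ?thesis using ij xs by (simp add: nth_eq_iff_index_eq)
  qed
  show ?thesis
  proof (rule that[of g])
    show "mat_inverse ?A = Some (list_mat xs xs g)" using B Bg by simp
  next
    fix a c assume "a \<in> set xs" "c \<in> set xs"
    then show "(\<Sum>b\<in>set xs. g a b * f b c) = (if a = c then 1 else 0)"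
      using inv(2) unfolding Bg list_mat_mult[OF xs] by (intro entries)
  next
    fix a c assume "a \<in> set xs" "c \<in> set xs"
    then show "(\<Sum>b\<in>set xs. f a b * g b c) = (if a = c then 1 else 0)"
      using inv(1) unfolding Bg list_mat_mult[OF xs] by (intro entries)
  qed
qed

lemma DN_eq_Schur_complement:
  fixes H Y :: "'a pair_pre_digraph"
  defines "I \<equiv> pverts H - pverts Y" and "ys \<equiv> enum_of (pverts Y)"
  assumes H: "pair_graph H" and Y: "pverts Y \<subseteq> pverts H" and det: "set_det I (laplacian H) \<noteq> 0"
  obtains g where "DN H Y = list_mat ys ys (Schur_complement I g (laplacian H))"
    and "\<And>a c. a \<in> I \<Longrightarrow> c \<in> I \<Longrightarrow> (\<Sum>b\<in>I. g a b * laplacian H b c) = (if a = c then 1 else 0)"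
    and "\<And>a c. a \<in> I \<Longrightarrow> c \<in> I \<Longrightarrow> (\<Sum>b\<in>I. laplacian H a b * g b c) = (if a = c then 1 else 0)"
proof -
  interpret pair_graph H by fact
  have fin: "finite I" "finite (pverts Y)"
    using pair_finite_verts finite_subset[OF Y pair_finite_verts] by (simp_all add: I_def)
  let ?xs = "enum_of I" and ?L = "laplacian H"
  have xs: "set ?xs = I" "distinct ?xs" and ys: "set ys = pverts Y" "distinct ys"
    using fin by (simp_all add: enum_of ys_def)
  obtain g where g: "mat_inverse (list_mat ?xs ?xs ?L) = Some (list_mat ?xs ?xs g)"
      "\<And>a c. a \<in> I \<Longrightarrow> c \<in> I \<Longrightarrow> (\<Sum>b\<in>I. g a b * ?L b c) = (if a = c then 1 else 0)"
      "\<And>a c. a \<in> I \<Longrightarrow> c \<in> I \<Longrightarrow> (\<Sum>b\<in>I. ?L a b * g b c) = (if a = c then 1 else 0)"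
    using mat_inverse_list_mat[OF xs(2), of ?L] det unfolding xs by blast
  have transp: "transpose_mat (list_mat ?xs ys ?L) = list_mat ys ?xs ?L"
    by (rule eq_matI) (auto simp: laplacian_sym[OF H])
  have "DN H Y = list_mat ys ys ?L - list_mat ys ?xs ?L * list_mat ?xs ?xs g * list_mat ?xs ys ?L"
    unfolding DN_def Let_def I_def[symmetric]
    by (simp add: mat_on_eq_list_mat fin ys_def[symmetric] g(1) transp)
  also have "\<dots> = list_mat ys ys (Schur_complement I g ?L)"
    by (rule eq_matI) (simp_all add: list_mat_mult xs Schur_complement_def)
  finally show ?thesis using g that by blast
qed

text \<open>
  With \<open>A\<close>, \<open>B\<close> the blocks of the rows indexed by \<open>V - Y\<close>, vanishing row sums say that \<open>B\<close>
  applied to the all-ones vector is \<open>-A\<close> applied to it. So \<open>A\<inverse> B\<close> maps the all-ones vector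
  to its negative, and the row sums of the Schur complement are row sums of \<open>f\<close>.
\<close>

lemma Schur_complement_row_sum:
  assumes fin: "finite V" and Y: "Y \<subseteq> V"
    and rows: "\<And>u. u \<in> V \<Longrightarrow> (\<Sum>v\<in>V. f u v) = 0"
    and inv: "\<And>a c. a \<in> V - Y \<Longrightarrow> c \<in> V - Y \<Longrightarrow> (\<Sum>b\<in>V - Y. g a b * f b c) = (if a = c then 1 else 0)"
    and u: "u \<in> Y"
  shows "(\<Sum>v\<in>Y. Schur_complement (V - Y) g f u v) = 0"
proof -
  let ?I = "V - Y"
  have fI: "finite ?I" using fin by simp
  have row: "(\<Sum>v\<in>Y. f b v) = - (\<Sum>c\<in>?I. f b c)" if "b \<in> V" for b
    using rows[OF that] sum.subset_diff[OF Y fin, of "f b"] by (simp add: eq_neg_iff_add_eq_0 add.commute)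
  have "(\<Sum>v\<in>Y. \<Sum>b\<in>?I. (\<Sum>a\<in>?I. f u a * g a b) * f b v) =
          (\<Sum>b\<in>?I. (\<Sum>a\<in>?I. f u a * g a b) * (\<Sum>v\<in>Y. f b v))"
    by (subst sum.swap) (simp add: sum_distrib_left)
  also have "\<dots> = - (\<Sum>b\<in>?I. (\<Sum>a\<in>?I. f u a * g a b) * (\<Sum>c\<in>?I. f b c))"
    by (simp add: row sum_negf)
  also have "(\<Sum>b\<in>?I. (\<Sum>a\<in>?I. f u a * g a b) * (\<Sum>c\<in>?I. f b c)) =
      (\<Sum>b\<in>?I. \<Sum>a\<in>?I. \<Sum>c\<in>?I. f u a * (g a b * f b c))"
    by (simp add: sum_product mult.assoc)
  also have "\<dots> = (\<Sum>a\<in>?I. \<Sum>b\<in>?I. \<Sum>c\<in>?I. f u a * (g a b * f b c))"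
    by (rule sum.swap)
  also have "\<dots> = (\<Sum>a\<in>?I. \<Sum>c\<in>?I. \<Sum>b\<in>?I. f u a * (g a b * f b c))"
    by (intro sum.cong refl sum.swap)
  also have "\<dots> = (\<Sum>a\<in>?I. \<Sum>c\<in>?I. if a = c then f u a else 0)"
    by (intro sum.cong refl) (simp add: sum_distrib_left[symmetric] inv)
  also have "\<dots> = (\<Sum>a\<in>?I. f u a)"
    using fI by simp
  finally show ?thesis
    using row[of u] u Y by (auto simp: Schur_complement_def sum_subtractf)
qed

lemma Schur_complement_transpose:
  "Schur_complement I g f v u = Schur_complement I (\<lambda>a b. g b a) (\<lambda>a b. f b a) u v"
proof -
  have "(\<Sum>b\<in>I. (\<Sum>a\<in>I. f v a * g a b) * f b u) = (\<Sum>b\<in>I. \<Sum>a\<in>I. f v a * g a b * f b u)"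
    by (simp add: sum_distrib_right)
  also have "\<dots> = (\<Sum>a\<in>I. \<Sum>b\<in>I. f v a * g a b * f b u)"
    by (rule sum.swap)
  also have "\<dots> = (\<Sum>a\<in>I. (\<Sum>b\<in>I. f b u * g a b) * f v a)"
    by (simp add: sum_distrib_right sum_distrib_left mult_ac)
  finally show ?thesis by (simp add: Schur_complement_def)
qed

lemma Schur_complement_col_sum:
  assumes fin: "finite V" and Y: "Y \<subseteq> V"
    and cols: "\<And>v. v \<in> V \<Longrightarrow> (\<Sum>u\<in>V. f u v) = 0"
    and inv: "\<And>a c. a \<in> V - Y \<Longrightarrow> c \<in> V - Y \<Longrightarrow> (\<Sum>b\<in>V - Y. f a b * g b c) = (if a = c then 1 else 0)"
    and v: "v \<in> Y"
  shows "(\<Sum>u\<in>Y. Schur_complement (V - Y) g f u v) = 0"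
  unfolding Schur_complement_transpose[of _ g f _ v]
  by (rule Schur_complement_row_sum) (use fin Y cols inv v in \<open>auto simp: mult.commute\<close>)

section \<open>Gluing along a common full subgraph\<close>

lemma pair_graph_basics:
  assumes "pair_graph H"
  shows pair_graph_finite_verts: "finite (pverts H)"
    and pair_graph_finite_arcs: "finite (parcs H)"
    and pair_graph_fst: "(u, v) \<in> parcs H \<Longrightarrow> u \<in> pverts H"
    and pair_graph_snd: "(u, v) \<in> parcs H \<Longrightarrow> v \<in> pverts H"
    and pair_graph_loopfree: "(u, u) \<notin> parcs H"
    and pair_graph_sym: "(u, v) \<in> parcs H \<Longrightarrow> (v, u) \<in> parcs H"
proof -
  interpret pair_graph H by fact
  show "finite (pverts H)" "finite (parcs H)" by (rule pair_finite_verts pair_finite_arcs)+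
  show "(u, v) \<in> parcs H \<Longrightarrow> u \<in> pverts H" "(u, v) \<in> parcs H \<Longrightarrow> v \<in> pverts H"
    by (rule in_arcsD1 in_arcsD2; assumption)+
  show "(u, u) \<notin> parcs H" using no_loops' by blast
  show "(u, v) \<in> parcs H \<Longrightarrow> (v, u) \<in> parcs H" by (rule arcs_symmetric)
qed

text \<open>
  The hypotheses are collected in a locale so that the structure of the glued graph can be
  developed before the counting argument.
\<close>

locale gluing =
  fixes G1 G2 Y :: "'a pair_pre_digraph"
  assumes G1: "pair_graph G1" "Digraph_Component.connected (with_proj G1)"
    and G2: "pair_graph G2" "Digraph_Component.connected (with_proj G2)"
    and Y: "pair_graph Y" "pverts Y \<noteq> {}"
    and full1: "induced_subgraph (with_proj Y) (with_proj G1)"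
    and full2: "induced_subgraph (with_proj Y) (with_proj G2)"
begin

abbreviation "G \<equiv> glue G1 Y G2"
abbreviation "I1 \<equiv> pverts G1 - pverts Y"
abbreviation "I2 \<equiv> pverts G2 - pverts Y"
abbreviation "inr \<equiv> glue_right Y"

lemma Y_sub: "pverts Y \<subseteq> pverts G1" "pverts Y \<subseteq> pverts G2"
  using full1 full2 by (auto simp: induced_subgraph_def subgraph_def)

lemma arcs_Y1: "(u, v) \<in> parcs Y \<longleftrightarrow> (u, v) \<in> parcs G1 \<and> u \<in> pverts Y \<and> v \<in> pverts Y"
  using full1 by (auto simp: induced_subgraph_def)

lemma arcs_Y2: "(u, v) \<in> parcs Y \<longleftrightarrow> (u, v) \<in> parcs G2 \<and> u \<in> pverts Y \<and> v \<in> pverts Y"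
  using full2 by (auto simp: induced_subgraph_def)

lemma inj_inr: "inr u = inr v \<longleftrightarrow> u = v"
  by (auto simp: glue_right_def)

lemma verts_G: "pverts G = Inl ` pverts G1 \<union> inr ` pverts G2"
  by (simp add: glue_def)

lemma arcs_G: "(a, b) \<in> parcs G \<longleftrightarrow>
    (\<exists>u v. a = Inl u \<and> b = Inl v \<and> (u, v) \<in> parcs G1) \<or>
    (\<exists>u v. a = inr u \<and> b = inr v \<and> (u, v) \<in> parcs G2)"
  by (auto simp: glue_def)

lemma arcs_G_Inl: "(Inl u, Inl v) \<in> parcs G \<longleftrightarrow> (u, v) \<in> parcs G1"
  unfolding arcs_G using arcs_Y1 arcs_Y2 by (auto simp: glue_right_def split: if_splits)

lemma arcs_G_inr: "(inr u, inr v) \<in> parcs G \<longleftrightarrow> (u, v) \<in> parcs G2"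
  unfolding arcs_G inj_inr using arcs_Y1 arcs_Y2 by (auto simp: glue_right_def split: if_splits)

lemma pair_graph_G: "pair_graph G"
proof
  fix e assume "e \<in> parcs G"
  then obtain a b where e: "e = (a, b)" "(a, b) \<in> parcs G" by (cases e) auto
  then show "fst e \<in> pverts G" "snd e \<in> pverts G" "fst e \<noteq> snd e"
    using pair_graph_fst[OF G1(1)] pair_graph_snd[OF G1(1)]
      pair_graph_fst[OF G2(1)] pair_graph_snd[OF G2(1)]
      pair_graph_loopfree[OF G1(1)] pair_graph_loopfree[OF G2(1)]
    by (auto simp: arcs_G verts_G inj_inr)
next
  show "finite (pverts G)" "finite (parcs G)"
    using pair_graph_finite_verts[OF G1(1)] pair_graph_finite_verts[OF G2(1)]
      pair_graph_finite_arcs[OF G1(1)] pair_graph_finite_arcs[OF G2(1)]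
    by (auto simp: glue_def)
  show "symmetric (with_proj G)"
    unfolding symmetric_def sym_def with_proj_simps arcs_G
    using pair_graph_sym[OF G1(1)] pair_graph_sym[OF G2(1)] by metis
qed

lemma laplacian_G_left:
  assumes "u \<in> I1 \<or> v \<in> I1"
  shows "laplacian G (Inl u) (Inl v) = laplacian G1 u v"
proof -
  have "parcs G `` {Inl u} = Inl ` (parcs G1 `` {u})" if "u \<in> I1"
    using that arcs_G_Inl by (auto simp: arcs_G glue_right_def split: if_splits)
  then show ?thesis
    using assms by (auto simp: laplacian_def arcs_G_Inl out_degree_eq_card card_image)
qed

lemma laplacian_G_right:
  assumes "u \<in> I2 \<or> v \<in> I2"
  shows "laplacian G (inr u) (inr v) = laplacian G2 u v"
proof -
  have "parcs G `` {inr u} = inr ` (parcs G2 `` {u})" if "u \<in> I2"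
    using that arcs_G_inr by (auto simp: arcs_G inj_inr) (auto simp: glue_right_def split: if_splits)
  moreover have "inj inr" by (rule injI) (simp add: inj_inr)
  ultimately show ?thesis
    using assms
    by (auto simp: laplacian_def arcs_G_inr out_degree_eq_card card_image inj_inr inj_on_subset)
qed

lemma laplacian_G_cross:
  assumes "u \<in> I1" "v \<notin> pverts Y"
  shows "laplacian G (Inl u) (Inr v) = 0" "laplacian G (Inr v) (Inl u) = 0"
  using assms by (auto simp: laplacian_def arcs_G glue_right_def split: if_splits)

text \<open>
  Edges at a vertex of \<open>Y\<close> come from both graphs, and exactly those inside \<open>Y\<close> are counted twice.
\<close>

lemma laplacian_G_common:
  assumes uv: "u \<in> pverts Y" "v \<in> pverts Y"
  shows "laplacian G (Inl u) (Inl v) = laplacian G1 u v + laplacian G2 u v - laplacian Y u v"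
proof (cases "u = v")
  case False
  then show ?thesis using uv arcs_Y1[of u v] arcs_Y2[of u v] by (auto simp: laplacian_def arcs_G_Inl)
next
  case True
  let ?N1 = "parcs G1 `` {u}" and ?N2 = "parcs G2 `` {u}"
  have inl: "Inl u = inr w \<longleftrightarrow> u = w" for w using uv by (auto simp: glue_right_def)
  have "parcs G `` {Inl u} = Inl ` ?N1 \<union> inr ` ?N2"
    unfolding set_eq_iff Image_singleton_iff Un_iff arcs_G image_iff inl sum.inject by blast
  moreover have "Inl ` ?N1 \<inter> inr ` ?N2 = Inl ` (parcs Y `` {u})"
  proof (rule Set.set_eqI)
    fix b :: "'a + 'a"
    have "Inl v \<in> inr ` ?N2 \<longleftrightarrow> v \<in> pverts Y \<and> (u, v) \<in> parcs G2" for v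
      by (auto simp: glue_right_def image_iff split: if_splits)
    then show "b \<in> Inl ` ?N1 \<inter> inr ` ?N2 \<longleftrightarrow> b \<in> Inl ` (parcs Y `` {u})"
      using uv arcs_Y1[of u] arcs_Y2[of u] by (cases b) auto
  qed
  moreover have "finite (Inl ` ?N1)" "finite (inr ` ?N2)"
    using finite_Image pair_graph_finite_arcs[OF G1(1)] pair_graph_finite_arcs[OF G2(1)] by blast+
  moreover have "card (inr ` ?N2) = card ?N2"
    by (intro card_image) (auto simp: inj_on_def inj_inr)
  ultimately have "card ?N1 + card ?N2 = card (parcs G `` {Inl u}) + card (parcs Y `` {u})"
    using card_Un_Int[of "Inl ` ?N1" "inr ` ?N2"] by (simp add: card_image)
  then show ?thesis
    using True by (simp add: laplacian_def out_degree_eq_card)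
qed

lemma reach_G:
  assumes y: "y \<in> pverts Y" and a: "a \<in> pverts G"
  shows "(a, Inl y) \<in> (parcs G)\<^sup>*"
proof -
  consider u where "u \<in> pverts G1" "a = Inl u" | u where "u \<in> pverts G2" "a = inr u"
    using a verts_G by auto
  then show ?thesis
  proof cases
    case 1
    have "(u, y) \<in> (parcs G1)\<^sup>*" using connected_rtrancl[OF G1] 1 y Y_sub by blast
    then have "(Inl u, Inl y) \<in> (parcs G)\<^sup>*"
      by (induction rule: rtrancl_induct) (auto intro: rtrancl_into_rtrancl simp: arcs_G_Inl)
    then show ?thesis using 1 by simp
  next
    case 2
    have "(u, y) \<in> (parcs G2)\<^sup>*" using connected_rtrancl[OF G2] 2 y Y_sub by blast
    then have "(inr u, inr y) \<in> (parcs G)\<^sup>*"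
      by (induction rule: rtrancl_induct) (auto intro: rtrancl_into_rtrancl simp: arcs_G_inr)
    then show ?thesis using 2 y by (simp add: glue_right_def)
  qed
qed

text \<open>
  No edge joins \<open>I1\<close> to \<open>I2\<close>, so eliminating \<open>I1\<close> leaves the rows and columns of \<open>I2\<close> unchanged
  and the two eliminations are independent. On \<open>Y\<close> each of them subtracts its correction term from
  the Laplacian of the glued graph, which is the sum of the two Laplacians minus that of \<open>Y\<close>.
\<close>

lemma set_det_laplacian_G:
  assumes y: "y \<in> pverts Y"
    and g1: "\<And>a c. a \<in> I1 \<Longrightarrow> c \<in> I1 \<Longrightarrow> (\<Sum>b\<in>I1. g1 a b * laplacian G1 b c) = (if a = c then 1 else 0)"
    and g2: "\<And>a c. a \<in> I2 \<Longrightarrow> c \<in> I2 \<Longrightarrow> (\<Sum>b\<in>I2. g2 a b * laplacian G2 b c) = (if a = c then 1 else 0)"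
  shows "set_det (pverts G - {Inl y}) (laplacian G) =
    set_det I1 (laplacian G1) * set_det I2 (laplacian G2) *
    set_det (pverts Y - {y}) (\<lambda>u v. Schur_complement I1 g1 (laplacian G1) u v +
       Schur_complement I2 g2 (laplacian G2) u v - laplacian Y u v)"
proof -
  let ?J = "pverts Y - {y}" and ?L = "laplacian G"
  let ?h1 = "\<lambda>a b. g1 (projl a) (projl b)" and ?h2 = "\<lambda>a b. g2 (projr a) (projr b)"
  define S1 where "S1 = Schur_complement (Inl ` I1) ?h1 ?L"
  define S2 where "S2 = Schur_complement (Inr ` I2) ?h2 S1"
  have fin: "finite I1" "finite I2" "finite ?J"
    using pair_graph_finite_verts[OF G1(1)] pair_graph_finite_verts[OF G2(1)] pair_graph_finite_verts[OF Y(1)] by auto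
  have inr_out: "inr v = Inr v" if "v \<in> I2" for v using that by (simp add: glue_right_def)
  have inr_in: "inr v = Inl v" if "v \<in> pverts Y" for v using that by (simp add: glue_right_def)
  have V: "pverts G - {Inl y} = Inl ` I1 \<union> (Inr ` I2 \<union> Inl ` ?J)"
    using y Y_sub by (auto simp: verts_G glue_right_def image_iff)
  have right: "?L (Inr u) (Inr v) = laplacian G2 u v" if "u \<in> I2" "v \<in> I2" for u v
    using laplacian_G_right[of u v] that inr_out by simp
  have right_common: "?L (Inr u) (Inl v) = laplacian G2 u v" "?L (Inl v) (Inr u) = laplacian G2 v u"
    if "u \<in> I2" "v \<in> pverts Y" for u v
    using laplacian_G_right[of u v] laplacian_G_right[of v u] that inr_out inr_in by simp_all
  have S1_row: "S1 (Inr u) b = ?L (Inr u) b" and S1_col: "S1 b (Inr u) = ?L b (Inr u)" if "u \<in> I2" for u b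
    using that laplacian_G_cross by (simp_all add: S1_def Schur_complement_def sum.reindex)
  have "set_det (pverts G - {Inl y}) ?L = set_det (Inl ` I1) ?L * set_det (Inr ` I2 \<union> Inl ` ?J) S1"
    unfolding V S1_def Schur_complement_def
    by (rule set_det_Schur)
       (use fin g1 laplacian_G_left in \<open>auto simp: sum.reindex split: if_splits\<close>)
  also have "set_det (Inr ` I2 \<union> Inl ` ?J) S1 = set_det (Inr ` I2) S1 * set_det (Inl ` ?J) S2"
    unfolding S2_def Schur_complement_def
    by (rule set_det_Schur) (use fin g2 S1_row right in \<open>auto simp: sum.reindex split: if_splits\<close>)
  also have "set_det (Inl ` I1) ?L = set_det I1 (\<lambda>u v. ?L (Inl u) (Inl v))"
    by (rule set_det_reindex) (use fin in \<open>auto simp: bij_betw_def\<close>)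
  also have "\<dots> = set_det I1 (laplacian G1)"
    by (rule set_det_cong) (use laplacian_G_left in auto)
  also have "set_det (Inr ` I2) S1 = set_det I2 (\<lambda>u v. S1 (Inr u) (Inr v))"
    by (rule set_det_reindex) (use fin in \<open>auto simp: bij_betw_def\<close>)
  also have "\<dots> = set_det I2 (laplacian G2)"
    by (rule set_det_cong) (use S1_row right in auto)
  also have "set_det (Inl ` ?J) S2 = set_det ?J (\<lambda>u v. S2 (Inl u) (Inl v))"
    by (rule set_det_reindex) (use fin in \<open>auto simp: bij_betw_def\<close>)
  also have "\<dots> = set_det ?J (\<lambda>u v. Schur_complement I1 g1 (laplacian G1) u v +
       Schur_complement I2 g2 (laplacian G2) u v - laplacian Y u v)"
  proof (rule set_det_cong[OF refl])
    fix u v assume "u \<in> ?J" "v \<in> ?J"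
    then have uv: "u \<in> pverts Y" "v \<in> pverts Y" by auto
    have "(\<Sum>b\<in>I1. (\<Sum>a\<in>I1. ?L (Inl u) (Inl a) * g1 a b) * ?L (Inl b) (Inl v)) =
        (\<Sum>b\<in>I1. (\<Sum>a\<in>I1. laplacian G1 u a * g1 a b) * laplacian G1 b v)"
      by (intro sum.cong refl arg_cong2[of _ _ _ _ "(*)"]) (simp_all add: laplacian_G_left)
    then have 1: "S1 (Inl u) (Inl v) = ?L (Inl u) (Inl v) -
        (\<Sum>b\<in>I1. (\<Sum>a\<in>I1. laplacian G1 u a * g1 a b) * laplacian G1 b v)"
      by (simp add: S1_def Schur_complement_def sum.reindex)
    have "(\<Sum>b\<in>I2. (\<Sum>a\<in>I2. S1 (Inl u) (Inr a) * g2 a b) * S1 (Inr b) (Inl v)) =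
        (\<Sum>b\<in>I2. (\<Sum>a\<in>I2. laplacian G2 u a * g2 a b) * laplacian G2 b v)"
      by (intro sum.cong refl arg_cong2[of _ _ _ _ "(*)"])
         (use uv in \<open>simp_all add: S1_row S1_col right_common\<close>)
    then have "S2 (Inl u) (Inl v) = S1 (Inl u) (Inl v) -
        (\<Sum>b\<in>I2. (\<Sum>a\<in>I2. laplacian G2 u a * g2 a b) * laplacian G2 b v)"
      by (simp add: S2_def Schur_complement_def sum.reindex)
    then show "S2 (Inl u) (Inl v) = Schur_complement I1 g1 (laplacian G1) u v +
       Schur_complement I2 g2 (laplacian G2) u v - laplacian Y u v"
      using 1 laplacian_G_common[OF uv] by (simp add: Schur_complement_def)
  qed
  finally show ?thesis by (simp add: mult.assoc)
qed

text \<open>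
  The root \<open>y\<close> for the spanning trees is the first vertex in the enumeration of \<open>pverts Y\<close>, so that
  deleting its row and column leaves a minor over the remaining list. The cofactor is non-zero because
  the minor of the connected glued graph is positive.
\<close>

lemma num_spanning_trees_G:
  "(of_nat (num_spanning_trees G) :: complex) =
     of_nat (num_rooted_spanning_forests G1 (pverts Y)) *
     of_nat (num_rooted_spanning_forests G2 (pverts Y)) *
     (pseudo_det (map_mat complex_of_real (DN_glue G1 Y G2)) / of_nat (card (pverts Y)))"
proof -
  let ?L1 = "laplacian G1" and ?L2 = "laplacian G2" and ?LY = "laplacian Y" and ?V = "pverts Y"
  have det1: "set_det I1 ?L1 \<noteq> 0"
    by (rule less_imp_neq[symmetric], rule laplacian_minor_pos[OF G1(1)])
       (use Y Y_sub connected_rtrancl[OF G1] in blast)+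
  have det2: "set_det I2 ?L2 \<noteq> 0"
    by (rule less_imp_neq[symmetric], rule laplacian_minor_pos[OF G2(1)])
       (use Y Y_sub connected_rtrancl[OF G2] in blast)+
  define xs where "xs = enum_of ?V"
  have xs: "set xs = ?V" "distinct xs" using pair_graph_finite_verts[OF Y(1)] by (simp_all add: xs_def enum_of)
  then obtain y ys where y: "xs = y # ys" using Y(2) by (cases xs) auto
  have yV: "y \<in> ?V" and ys: "set ys = ?V - {y}" using xs y by auto
  obtain g1 where g1: "DN G1 Y = list_mat xs xs (Schur_complement I1 g1 ?L1)"
      "\<And>a c. a \<in> I1 \<Longrightarrow> c \<in> I1 \<Longrightarrow> (\<Sum>b\<in>I1. g1 a b * ?L1 b c) = (if a = c then 1 else 0)"
      "\<And>a c. a \<in> I1 \<Longrightarrow> c \<in> I1 \<Longrightarrow> (\<Sum>b\<in>I1. ?L1 a b * g1 b c) = (if a = c then 1 else 0)"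
  proof (rule DN_eq_Schur_complement[OF G1(1) Y_sub(1) det1, folded xs_def], goal_cases)
    case (1 g)
    from 1(2-) show ?case by (rule 1(1))
  qed
  obtain g2 where g2: "DN G2 Y = list_mat xs xs (Schur_complement I2 g2 ?L2)"
      "\<And>a c. a \<in> I2 \<Longrightarrow> c \<in> I2 \<Longrightarrow> (\<Sum>b\<in>I2. g2 a b * ?L2 b c) = (if a = c then 1 else 0)"
      "\<And>a c. a \<in> I2 \<Longrightarrow> c \<in> I2 \<Longrightarrow> (\<Sum>b\<in>I2. ?L2 a b * g2 b c) = (if a = c then 1 else 0)"
  proof (rule DN_eq_Schur_complement[OF G2(1) Y_sub(2) det2, folded xs_def], goal_cases)
    case (1 g)
    from 1(2-) show ?case by (rule 1(1))
  qed
  define S where "S u v = Schur_complement I1 g1 ?L1 u v + Schur_complement I2 g2 ?L2 u v - ?LY u v" for u v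
  have DN: "DN_glue G1 Y G2 = list_mat xs xs S"
    unfolding DN_glue_def g1(1) g2(1)
      mat_on_eq_list_mat[OF pair_graph_finite_verts[OF Y(1)] pair_graph_finite_verts[OF Y(1)]]
      xs_def[symmetric]
    by (rule eq_matI) (auto simp: S_def)
  have col1: "(\<Sum>u\<in>pverts H. laplacian H u v) = 0" if "pair_graph H" "v \<in> pverts H" for H :: "'a pair_pre_digraph" and v
    using laplacian_row_sum[OF that] by (simp add: laplacian_sym[OF that(1), of _ v])
  have S_row: "(\<Sum>v\<in>?V. S u v) = 0" if "u \<in> ?V" for u
    using Schur_complement_row_sum[OF pair_graph_finite_verts[OF G1(1)] Y_sub(1) laplacian_row_sum[OF G1(1)] g1(2) that]
      Schur_complement_row_sum[OF pair_graph_finite_verts[OF G2(1)] Y_sub(2) laplacian_row_sum[OF G2(1)] g2(2) that]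
      laplacian_row_sum[OF Y(1) that]
    by (simp add: S_def sum_subtractf sum.distrib)
  have S_col: "(\<Sum>u\<in>?V. S u v) = 0" if "v \<in> ?V" for v
    using Schur_complement_col_sum[OF pair_graph_finite_verts[OF G1(1)] Y_sub(1) col1[OF G1(1)] g1(3) that]
      Schur_complement_col_sum[OF pair_graph_finite_verts[OF G2(1)] Y_sub(2) col1[OF G2(1)] g2(3) that]
      col1[OF Y(1) that]
    by (simp add: S_def sum_subtractf sum.distrib)
  have yG: "Inl y \<in> pverts G" using yV Y_sub verts_G by auto
  have detG: "set_det (pverts G - {Inl y}) (laplacian G) =
      set_det I1 ?L1 * set_det I2 ?L2 * set_det (set ys) S"
    using set_det_laplacian_G[OF yV g1(2) g2(2)] by (simp add: ys S_def[abs_def])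
  have "set_det (pverts G - {Inl y}) (laplacian G) > 0"
    by (rule laplacian_minor_pos[OF pair_graph_G]) (use reach_G[OF yV] in blast)+
  then have S_nz: "set_det (set ys) S \<noteq> 0" using detG by auto
  have "pseudo_det (list_mat xs xs (\<lambda>u v. complex_of_real (S u v))) =
      of_nat (Suc (length ys)) * set_det (set ys) (\<lambda>u v. complex_of_real (S u v))"
    unfolding y
    by (rule pseudo_det_zero_sums)
       (use xs(1)[unfolded y] xs(2)[unfolded y] S_row S_col S_nz in
         \<open>simp_all only: of_real_sum[symmetric] of_real_set_det[symmetric] of_real_0 of_real_eq_0_iff not_False_eq_True\<close>)
  moreover have "map_mat complex_of_real (DN_glue G1 Y G2) = list_mat xs xs (\<lambda>u v. complex_of_real (S u v))"
    unfolding DN by (rule eq_matI) auto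
  moreover have "card ?V = Suc (length ys)"
    using distinct_card[OF xs(2)] xs y by simp
  ultimately have pd: "pseudo_det (map_mat complex_of_real (DN_glue G1 Y G2)) / of_nat (card ?V) =
      complex_of_real (set_det (set ys) S)"
    by (simp add: of_real_set_det del: of_nat_Suc)
  have "real (num_spanning_trees G) = set_det (pverts G - {Inl y}) (laplacian G)"
    using num_spanning_trees_eq[OF pair_graph_G yG] card_rooted_forests[OF pair_graph_G, of "{Inl y}"]
      set_det_laplacian_eq_card_parent_maps[OF pair_graph_G, of "pverts G - {Inl y}"] yG by simp
  moreover have "real (num_rooted_spanning_forests G1 ?V) = set_det I1 ?L1"
    using num_rooted_spanning_forests_eq[OF G1(1) Y_sub(1)] card_rooted_forests[OF G1(1) Y_sub(1)]
      set_det_laplacian_eq_card_parent_maps[OF G1(1), of I1] by simp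
  moreover have "real (num_rooted_spanning_forests G2 ?V) = set_det I2 ?L2"
    using num_rooted_spanning_forests_eq[OF G2(1) Y_sub(2)] card_rooted_forests[OF G2(1) Y_sub(2)]
      set_det_laplacian_eq_card_parent_maps[OF G2(1), of I2] by simp
  ultimately have "real (num_spanning_trees G) = real (num_rooted_spanning_forests G1 ?V) *
      real (num_rooted_spanning_forests G2 ?V) * set_det (set ys) S"
    using detG by simp
  then show ?thesis
    unfolding pd by (metis of_real_mult of_real_of_nat_eq)
qed

end

theorem corollary3p2:
  fixes G1 G2 Y :: "'a pair_pre_digraph"
  assumes "pair_graph G1" and "Digraph_Component.connected (with_proj G1)"
    and "pair_graph G2" and "Digraph_Component.connected (with_proj G2)"
    and "pair_graph Y" and "pverts Y \<noteq> {}"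
    and "induced_subgraph (with_proj Y) (with_proj G1)"
    and "induced_subgraph (with_proj Y) (with_proj G2)"
  shows "(of_nat (num_spanning_trees (glue G1 Y G2)) :: complex) =
           of_nat (num_rooted_spanning_forests G1 (pverts Y)) *
           of_nat (num_rooted_spanning_forests G2 (pverts Y)) *
           (pseudo_det (map_mat complex_of_real (DN_glue G1 Y G2)) / of_nat (card (pverts Y)))"
proof -
  interpret gluing G1 G2 Y by (rule gluing.intro) (fact assms)+
  show ?thesis by (rule num_spanning_trees_G)
qed

end
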